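(* Let $K$ be a field of characteristic zero, $X=K^2$ with coordinates $x,y$, and let $f = x^m + y^l + 1 \in K[x,y]$ with positive integers $l,m$. Then the multiplicity of the left $D_X$-module $K[x,y,f^{-1}]$ equals $lm + |l-m| + 1$.
   Context: $D_X=K[x,y]\langle\partial_x,\partial_y\rangle$ is the Weyl algebra in the two variables $x,y$. Multiplicity (in the sense of Bernstein): let $F_k(D_X)$ be the $K$-span of monomials $x^{\alpha_1}y^{\alpha_2}\partial_x^{\beta_1}\partial_y^{\beta_2}$ with $\alpha_1+\alpha_2+\beta_1+\beta_2\le k$. A good Bernstein filtration on a finitely generated left $D_X$-module $N$ is a family of the form $F_k(N)=F_{k-k_1}(D_X)u_1+\cdots+F_{k-k_r}(D_X)u_r$ ($k\in\mathbb{Z}$) with $u_1,\dots,u_r$ generating $N$. For $k\gg0$, $\dim_KF_k(N)$ is a polynomial in $k$ with leading term $c_dk^d$; $d$ is the dimension of $N$ and $d!\,c_d$ is the multiplicity of $N$, both independent of the good filtration. *)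

theory Defs
  imports
    "HOL-Library.Poly_Mapping"
    "HOL-Computational_Algebra.Computational_Algebra"
begin

section \<open>Derivations of a fraction field\<close>

locale derivation =
  fixes D :: "'b::comm_ring_1 \<Rightarrow> 'b"
  assumes D_add: "D (u + v) = D u + D v"
    and D_mult: "D (u * v) = D u * v + u * D v"
begin

lemma D_0 [simp]: "D 0 = 0"
  using D_add[of 0 0] by simp

lemma D_1 [simp]: "D 1 = 0"
  using D_mult[of 1 1] by simp

lemma D_minus: "D (- u) = - D u"
  using D_add[of u "- u"] by (simp add: eq_neg_iff_add_eq_0 add.commute)

lemma D_diff: "D (u - v) = D u - D v"
  using D_add[of u "- v"] by (simp add: D_minus)

lemma D_sum: "D (\<Sum>i\<in>A. g i) = (\<Sum>i\<in>A. D (g i))"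
  by (induction A rule: infinite_finite_induct) (simp_all add: D_add)

lemma iter_add: "(D ^^ n) (u + v) = (D ^^ n) u + (D ^^ n) v"
  by (induction n) (simp_all add: D_add)

lemma iter_0 [simp]: "(D ^^ n) 0 = 0"
  by (induction n) simp_all

lemma iter_sum: "(D ^^ n) (\<Sum>i\<in>A. g i) = (\<Sum>i\<in>A. (D ^^ n) (g i))"
  by (induction A rule: infinite_finite_induct) (simp_all add: iter_add)

lemma iter_mult_const:
  assumes "D c = 0"
  shows "(D ^^ n) (c * u) = c * (D ^^ n) u"
  using assms by (induction n) (simp_all add: D_mult)

lemma D_power_const: "D c = 0 \<Longrightarrow> D (c ^ n) = 0"
  by (induction n) (simp_all add: D_mult)

lemma iter_power:
  assumes "D x = 1"
  shows "(D ^^ n) (x ^ a) = of_nat (fact n * (a choose n)) * x ^ (a - n)"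
proof (induction n)
  case (Suc n)
  have pow: "D (x ^ k) = of_nat k * x ^ (k - 1)" for k
  proof (induction k)
    case (Suc k)
    then show ?case using assms by (cases k) (simp_all add: D_mult algebra_simps)
  qed simp
  have c: "D (of_nat k) = 0" for k
    by (induction k) (simp_all add: D_add)
  have "fact n * (a choose n) * (a - n) = fact (Suc n) * (a choose Suc n)"
  proof -
    have "(a - n) * (a choose n) = Suc n * (a choose Suc n)"
      by (simp only: binomial_absorb_comp binomial_absorption)
    then show ?thesis by (simp add: algebra_simps)
  qed
  then show ?case
    using Suc by (simp add: D_mult c pow mult.assoc[symmetric] del: fact_Suc binomial_Suc_Suc flip: of_nat_mult)
qed simp

lemma leibniz:
  "(D ^^ n) (u * v) = (\<Sum>i\<le>n. of_nat (n choose i) * (D ^^ i) u * (D ^^ (n - i)) v)"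
proof (induction n)
  case (Suc n)
  have c: "D (of_nat k) = 0" for k
    by (induction k) (simp_all add: D_add)
  have "(D ^^ Suc n) (u * v) =
      (\<Sum>i\<le>n. of_nat (n choose i) * (D ^^ Suc i) u * (D ^^ (n - i)) v)
    + (\<Sum>i\<le>n. of_nat (n choose i) * (D ^^ i) u * (D ^^ (Suc n - i)) v)"
    using Suc by (simp add: D_sum D_mult c sum.distrib algebra_simps Suc_diff_le)
  also have "(\<Sum>i\<le>n. of_nat (n choose i) * (D ^^ Suc i) u * (D ^^ (n - i)) v)
      = (\<Sum>i\<le>Suc n. of_nat (case i of 0 \<Rightarrow> 0 | Suc j \<Rightarrow> n choose j)
           * (D ^^ i) u * (D ^^ (Suc n - i)) v)"
    by (simp only: sum.atMost_Suc_shift nat.case of_nat_0 mult_zero_left add_0_left diff_Suc_Suc)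
  also have "(\<Sum>i\<le>n. of_nat (n choose i) * (D ^^ i) u * (D ^^ (Suc n - i)) v)
      = (\<Sum>i\<le>Suc n. of_nat (n choose i) * (D ^^ i) u * (D ^^ (Suc n - i)) v)"
    by (simp add: binomial_eq_0)
  finally show ?case
    by (simp only: flip: sum.distrib distrib_right of_nat_add)
      (intro sum.cong refl, simp split: nat.split)
qed simp

end

text \<open>The extension of a derivation to the fraction field, by the quotient rule.\<close>

definition fract_deriv :: "('b::idom \<Rightarrow> 'b) \<Rightarrow> 'b fract \<Rightarrow> 'b fract" where
  "fract_deriv D u =
     (THE v. \<forall>p q. q \<noteq> 0 \<longrightarrow> u = Fract p q \<longrightarrow> v = Fract (D p * q - p * D q) (q * q))"

lemma fract_deriv_Fract:
  fixes D :: "'b::idom \<Rightarrow> 'b"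
  assumes "derivation D" "b \<noteq> 0"
  shows "fract_deriv D (Fract a b) = Fract (D a * b - a * D b) (b * b)"
proof -
  interpret derivation D by fact
  have "Fract (D a * b - a * D b) (b * b) = Fract (D c * d - c * D d) (d * d)"
    if "d \<noteq> 0" "Fract a b = Fract c d" for c d
  proof -
    have eq: "a * d = c * b"
      using that assms(2) by (simp add: eq_fract)
    have "(D a * d + a * D d) * (b * d) = (D c * b + c * D b) * (b * d)"
      using D_mult[of a d] D_mult[of c b] eq by simp
    moreover have "D a * b * (d * d) - a * D b * (d * d) - (D c * d * (b * b) - c * D d * (b * b))
        = (D a * d + a * D d) * (b * d) - (D c * b + c * D b) * (b * d)
          - (a * d - c * b) * (D d * b + D b * d)"
      by (simp add: algebra_simps)
    ultimately have "(D a * b - a * D b) * (d * d) = (D c * d - c * D d) * (b * b)"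
      using eq by (simp add: algebra_simps)
    then show ?thesis
      using that assms(2) by (simp add: eq_fract)
  qed
  then show ?thesis
    unfolding fract_deriv_def using assms(2) by (intro the_equality) blast+
qed

lemma to_fract_power: "to_fract (p ^ n) = to_fract p ^ n"
  by (induction n) simp_all

lemma derivation_fract_deriv:
  fixes D :: "'b::idom \<Rightarrow> 'b"
  assumes "derivation D"
  shows "derivation (fract_deriv D)"
proof
  interpret derivation D by fact
  note [simp] = fract_deriv_Fract[OF assms]
  fix u v :: "'b fract"
  show "fract_deriv D (u + v) = fract_deriv D u + fract_deriv D v"
    by (cases u; cases v) (simp add: eq_fract D_add D_mult, simp add: algebra_simps)
  show "fract_deriv D (u * v) = fract_deriv D u * v + u * fract_deriv D v"
    by (cases u; cases v) (simp add: eq_fract D_mult, simp add: algebra_simps)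
qed

lemma fract_deriv_to_fract:
  assumes "derivation D"
  shows "fract_deriv D (to_fract p) = to_fract (D p)"
proof -
  interpret derivation D by fact
  show ?thesis
    by (simp add: to_fract_def fract_deriv_Fract[OF assms])
qed

section \<open>Rational functions in two variables\<close>

text \<open>
  K[x,y] is \<open>'a poly poly\<close>, where the inner variable is x and the outer variable is y.
  Accordingly, K(x,y) is \<open>'a poly poly fract\<close>.
\<close>

definition ratfun_const :: "'a::field_char_0 \<Rightarrow> 'a poly poly fract" where
  "ratfun_const c = to_fract [:[:c:]:]"

definition ratfun_x :: "'a::field_char_0 poly poly fract" where
  "ratfun_x = to_fract [:[:0, 1:]:]"

definition ratfun_y :: "'a::field_char_0 poly poly fract" where
  "ratfun_y = to_fract [:0, 1:]"

definition ratfun_dx :: "'a::field_char_0 poly poly fract \<Rightarrow> 'a poly poly fract" where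
  "ratfun_dx = fract_deriv (map_poly pderiv)"

definition ratfun_dy :: "'a::field_char_0 poly poly fract \<Rightarrow> 'a poly poly fract" where
  "ratfun_dy = fract_deriv pderiv"

lemma ratfun_const_simps [simp]:
  "ratfun_const 0 = 0" "ratfun_const 1 = 1"
  "ratfun_const (c + d) = ratfun_const c + ratfun_const d"
  "ratfun_const (c * d) = ratfun_const c * ratfun_const d"
  by (simp_all add: ratfun_const_def one_pCons[symmetric] flip: to_fract_add to_fract_mult)

lemma ratfun_const_of_nat [simp]: "ratfun_const (of_nat n) = of_nat n"
  by (induction n) simp_all

lemma ratfun_const_fact [simp]: "ratfun_const (fact n) = of_nat (fact n)"
  using ratfun_const_of_nat[of "fact n"] by simp

lemma ratfun_monom:
  "ratfun_const k * ratfun_x ^ a * ratfun_y ^ b = to_fract (monom (monom k a) b)"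
proof (induction b)
  case 0
  show ?case
  proof (induction a)
    case (Suc a)
    have "ratfun_const k * ratfun_x ^ Suc a * ratfun_y ^ 0
        = ratfun_x * (ratfun_const k * ratfun_x ^ a * ratfun_y ^ 0)"
      by (simp add: mult_ac)
    then show ?case
      by (simp only: Suc) (simp add: ratfun_x_def monom_Suc monom_0 flip: to_fract_mult)
  qed (simp add: ratfun_const_def monom_0)
next
  case (Suc b)
  have "ratfun_const k * ratfun_x ^ a * ratfun_y ^ Suc b
      = ratfun_y * (ratfun_const k * ratfun_x ^ a * ratfun_y ^ b)"
    by (simp add: mult_ac)
  then show ?case
    by (simp only: Suc) (simp add: ratfun_y_def monom_Suc flip: to_fract_mult)
qed

lemma derivation_poly_dx: "derivation (map_poly pderiv :: 'a::field_char_0 poly poly \<Rightarrow> _)"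
  by standard
    (rule poly_eqI; simp add: coeff_map_poly pderiv_add coeff_mult pderiv_mult sum.distrib
      additive.sum[OF additive.intro[of pderiv], OF pderiv_add]; simp add: add.commute mult.commute)+

lemma derivation_poly_dy: "derivation (pderiv :: 'a::field_char_0 poly poly \<Rightarrow> _)"
  by standard (simp_all add: pderiv_add pderiv_mult algebra_simps)

interpretation dx: derivation "ratfun_dx :: 'a::field_char_0 poly poly fract \<Rightarrow> _"
  unfolding ratfun_dx_def by (rule derivation_fract_deriv[OF derivation_poly_dx])

interpretation dy: derivation "ratfun_dy :: 'a::field_char_0 poly poly fract \<Rightarrow> _"
  unfolding ratfun_dy_def by (rule derivation_fract_deriv[OF derivation_poly_dy])

lemma ratfun_deriv_simps [simp]:
  "ratfun_dx ratfun_x = 1" "ratfun_dx ratfun_y = 0" "ratfun_dx (ratfun_const c) = 0"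
  "ratfun_dy ratfun_x = 0" "ratfun_dy ratfun_y = 1" "ratfun_dy (ratfun_const c) = 0"
  by (simp_all add: ratfun_x_def ratfun_y_def ratfun_const_def ratfun_dx_def ratfun_dy_def
      fract_deriv_to_fract[OF derivation_poly_dx] fract_deriv_to_fract[OF derivation_poly_dy]
      map_poly_pCons pderiv_pCons map_poly_1 one_pCons[symmetric])

lemma ratfun_dx_dy: "ratfun_dx (ratfun_dy u) = ratfun_dy (ratfun_dx u)"
proof -
  interpret px: derivation "map_poly pderiv :: 'a poly poly \<Rightarrow> _" by (rule derivation_poly_dx)
  interpret py: derivation "pderiv :: 'a poly poly \<Rightarrow> _" by (rule derivation_poly_dy)
  have "map_poly pderiv (pderiv p) = pderiv (map_poly pderiv p)" for p :: "'a poly poly"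
    by (rule poly_eqI) (simp add: coeff_map_poly coeff_pderiv pderiv_mult del: of_nat_Suc)
  then show ?thesis
    by (cases u)
      (simp add: ratfun_dx_def ratfun_dy_def fract_deriv_Fract[OF derivation_poly_dx]
        fract_deriv_Fract[OF derivation_poly_dy] eq_fract px.D_diff py.D_diff px.D_mult py.D_mult,
       simp add: algebra_simps)
qed

section \<open>The Weyl algebra\<close>

text \<open>
  The exponent tuple \<open>(a, b, c, d)\<close> stands for the normally ordered monomial
  \<open>x ^ a * y ^ b * dx ^ c * dy ^ d\<close>; these monomials form a K-basis of the Weyl algebra.
\<close>

type_synonym exponents = "nat \<times> nat \<times> nat \<times> nat"

typedef (overloaded) 'a weyl = "UNIV :: (exponents \<Rightarrow>\<^sub>0 'a::field_char_0) set"
  morphisms weyl_coeffs Weyl ..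

setup_lifting type_definition_weyl

text \<open>
  The normally ordered form of the product of two monomials, from
  \<open>dx ^ c * x ^ a' = (\<Sum>i\<le>c. (c choose i) * i! * (a' choose i) * x ^ (a' - i) * dx ^ (c - i))\<close>
  and the same for y.
\<close>

fun monomial_times :: "exponents \<Rightarrow> exponents \<Rightarrow> exponents \<Rightarrow>\<^sub>0 'a::field_char_0" where
  "monomial_times (a, b, c, d) (a', b', c', d') =
     (\<Sum>i\<le>c. \<Sum>j\<le>d. Poly_Mapping.single (a + (a' - i), b + (b' - j), (c - i) + c', (d - j) + d')
        (of_nat ((c choose i) * (fact i * (a' choose i)) * ((d choose j) * (fact j * (b' choose j))))))"

instantiation weyl :: (field_char_0) "{zero, one, plus, minus, uminus, times}"
begin

lift_definition zero_weyl :: "'a weyl" is 0 .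
lift_definition one_weyl :: "'a weyl" is "Poly_Mapping.single (0, 0, 0, 0) 1" .
lift_definition plus_weyl :: "'a weyl \<Rightarrow> 'a weyl \<Rightarrow> 'a weyl" is "(+)" .
lift_definition minus_weyl :: "'a weyl \<Rightarrow> 'a weyl \<Rightarrow> 'a weyl" is "(-)" .
lift_definition uminus_weyl :: "'a weyl \<Rightarrow> 'a weyl" is uminus .
lift_definition times_weyl :: "'a weyl \<Rightarrow> 'a weyl \<Rightarrow> 'a weyl" is
  "\<lambda>P Q. \<Sum>m\<in>Poly_Mapping.keys P. \<Sum>n\<in>Poly_Mapping.keys Q.
     Poly_Mapping.map ((*) (Poly_Mapping.lookup P m * Poly_Mapping.lookup Q n)) (monomial_times m n)" .

instance ..

end

text \<open>The action on rational functions by differential operators.\<close>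

fun monomial_op :: "exponents \<Rightarrow> 'a::field_char_0 poly poly fract \<Rightarrow> 'a poly poly fract" where
  "monomial_op (a, b, c, d) u =
     ratfun_x ^ a * ratfun_y ^ b * (ratfun_dx ^^ c) ((ratfun_dy ^^ d) u)"

definition ratfun_act :: "'a::field_char_0 weyl \<Rightarrow> 'a poly poly fract \<Rightarrow> 'a poly poly fract" where
  "ratfun_act P u =
     (\<Sum>m\<in>Poly_Mapping.keys (weyl_coeffs P).
        ratfun_const (Poly_Mapping.lookup (weyl_coeffs P) m) * monomial_op m u)"

lemma monomial_op_add: "monomial_op m (u + v) = monomial_op m u + monomial_op m v"
  by (cases m) (simp add: dx.iter_add dy.iter_add distrib_left)

lemma monomial_op_0 [simp]: "monomial_op m 0 = 0"
  by (cases m) simp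

lemma monomial_op_sum: "monomial_op m (\<Sum>i\<in>A. g i) = (\<Sum>i\<in>A. monomial_op m (g i))"
  by (induction A rule: infinite_finite_induct) (simp_all add: monomial_op_add)

lemma monomial_op_const:
  "monomial_op m (ratfun_const k * u) = ratfun_const k * monomial_op m u"
  by (cases m) (simp add: dx.iter_mult_const dy.iter_mult_const)

lemma monomial_op_1 [simp]: "monomial_op (0, 0, 0, 0) u = u"
  by simp

lemma Weyl_cases: obtains p where "P = Weyl p"
  by (metis weyl_coeffs_inverse)

lemma weyl_coeffs_Weyl [simp]: "weyl_coeffs (Weyl p) = p"
  by (simp add: Weyl_inverse)

lemma ratfun_act_superset:
  assumes "finite S" "Poly_Mapping.keys p \<subseteq> S"
  shows "ratfun_act (Weyl p) u =
    (\<Sum>m\<in>S. ratfun_const (Poly_Mapping.lookup p m) * monomial_op m u)"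
  unfolding ratfun_act_def weyl_coeffs_Weyl using assms
  by (intro sum.mono_neutral_left) (auto simp: in_keys_iff)

lemma ratfun_act_Weyl_add:
  "ratfun_act (Weyl (p + q)) u = ratfun_act (Weyl p) u + ratfun_act (Weyl q) u"
proof -
  let ?S = "Poly_Mapping.keys p \<union> Poly_Mapping.keys q"
  note sup = ratfun_act_superset[of ?S _ u]
  show ?thesis
    using Poly_Mapping.keys_add[of p q]
    by (simp add: sup lookup_add sum.distrib distrib_right)
qed

lemma ratfun_act_Weyl_0 [simp]: "ratfun_act (Weyl 0) u = 0"
  by (simp add: ratfun_act_def)

lemma ratfun_act_Weyl_sum:
  "ratfun_act (Weyl (\<Sum>i\<in>A. p i)) u = (\<Sum>i\<in>A. ratfun_act (Weyl (p i)) u)"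
  by (induction A rule: infinite_finite_induct) (simp_all add: ratfun_act_Weyl_add)

lemma ratfun_act_Weyl_single:
  "ratfun_act (Weyl (Poly_Mapping.single m k)) u = ratfun_const k * monomial_op m u"
  by (simp add: ratfun_act_superset[of "{m}"])

lemma ratfun_act_Weyl_map:
  "ratfun_act (Weyl (Poly_Mapping.map ((*) k) p)) u = ratfun_const k * ratfun_act (Weyl p) u"
proof -
  have l: "Poly_Mapping.lookup (Poly_Mapping.map ((*) k) p) m = k * Poly_Mapping.lookup p m" for m
    by (simp add: Poly_Mapping.map.rep_eq when_def)
  have "Poly_Mapping.keys (Poly_Mapping.map ((*) k) p) \<subseteq> Poly_Mapping.keys p"
    by (auto simp: in_keys_iff l)
  then show ?thesis
    by (simp add: ratfun_act_superset[of "Poly_Mapping.keys p"] l sum_distrib_left mult.assoc)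
qed

lemma ratfun_dx_dy_iter:
  "(ratfun_dx ^^ m) ((ratfun_dy ^^ n) u) = (ratfun_dy ^^ n) ((ratfun_dx ^^ m) u)"
proof -
  have "(ratfun_dy ^^ n) (ratfun_dx v) = ratfun_dx ((ratfun_dy ^^ n) v)"
    for v :: "'a poly poly fract"
    by (induction n) (simp_all add: ratfun_dx_dy)
  then show ?thesis
    by (induction m) simp_all
qed

lemma ratfun_act_monomial_times:
  "ratfun_act (Weyl (monomial_times m n)) u = monomial_op m (monomial_op n u)"
proof (cases m; cases n)
  fix a b c d a' b' c' d'
  assume m: "m = (a, b, c, d)" and n: "n = (a', b', c', d')"
  define v where "v = (ratfun_dx ^^ c') ((ratfun_dy ^^ d') u)"
  define C where "C i = (of_nat ((c choose i) * (fact i * (a' choose i))) :: 'a poly poly fract)" for i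
  define E where "E j = (of_nat ((d choose j) * (fact j * (b' choose j))) :: 'a poly poly fract)" for j
  have const: "ratfun_dx (of_nat k) = 0" "ratfun_dy (of_nat k) = 0" for k
    using ratfun_deriv_simps(3,6)[of "of_nat k"] by simp_all
  have 1: "(ratfun_dy ^^ d) (ratfun_x ^ a' * (ratfun_y ^ b' * v))
      = ratfun_x ^ a' * (\<Sum>j\<le>d. E j * ratfun_y ^ (b' - j) * (ratfun_dy ^^ (d - j)) v)"
    by (subst dy.iter_mult_const)
      (simp_all add: dy.D_power_const dy.leibniz dy.iter_power E_def mult.assoc)
  have 2: "(ratfun_dx ^^ k) (E j * ratfun_y ^ (b' - j) * w) = E j * ratfun_y ^ (b' - j) * (ratfun_dx ^^ k) w"
    for k j w
    by (subst dx.iter_mult_const) (simp_all add: dx.D_mult dx.D_power_const E_def const)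
  have 3: "(ratfun_dx ^^ (c - i)) ((ratfun_dy ^^ (d - j)) v)
      = (ratfun_dx ^^ (c - i + c')) ((ratfun_dy ^^ (d - j + d')) u)" for i j
    unfolding v_def by (simp add: funpow_add ratfun_dx_dy_iter)
  have 4: "(ratfun_dx ^^ c) (ratfun_x ^ a' * w)
      = (\<Sum>i\<le>c. C i * ratfun_x ^ (a' - i) * (ratfun_dx ^^ (c - i)) w)" for w
    by (simp add: dx.leibniz dx.iter_power C_def mult.assoc)
  have 5: "(ratfun_dx ^^ k) (\<Sum>j\<le>d. E j * ratfun_y ^ (b' - j) * (ratfun_dy ^^ (d - j)) v)
      = (\<Sum>j\<le>d. E j * ratfun_y ^ (b' - j) * (ratfun_dx ^^ k) ((ratfun_dy ^^ (d - j)) v))" for k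
    by (simp add: dx.iter_sum 2)
  have "monomial_op m (monomial_op n u)
      = ratfun_x ^ a * ratfun_y ^ b * (\<Sum>i\<le>c. C i * ratfun_x ^ (a' - i) *
          (\<Sum>j\<le>d. E j * ratfun_y ^ (b' - j)
            * (ratfun_dx ^^ (c - i + c')) ((ratfun_dy ^^ (d - j + d')) u)))"
    unfolding m n monomial_op.simps v_def[symmetric] mult.assoc[of "ratfun_x ^ a'"] 1 4 5 3 ..
  also have "\<dots> = ratfun_act (Weyl (monomial_times m n)) u"
    unfolding m n monomial_times.simps
    by (simp add: ratfun_act_Weyl_sum ratfun_act_Weyl_single C_def E_def sum_distrib_left
        power_add mult_ac)
  finally show ?thesis ..
qed

lemma ratfun_act_add_left: "ratfun_act (P + Q) u = ratfun_act P u + ratfun_act Q u"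
  by (cases P rule: Weyl_cases; cases Q rule: Weyl_cases)
    (simp add: plus_weyl.abs_eq ratfun_act_Weyl_add)

lemma ratfun_act_add_right: "ratfun_act P (u + v) = ratfun_act P u + ratfun_act P v"
  by (simp add: ratfun_act_def monomial_op_add distrib_left sum.distrib)

lemma ratfun_act_1: "ratfun_act 1 u = u"
  by (simp add: one_weyl.abs_eq ratfun_act_Weyl_single)

lemma ratfun_act_times: "ratfun_act (P * Q) u = ratfun_act P (ratfun_act Q u)"
  unfolding times_weyl_def
  by (simp add: map_fun_def o_def ratfun_act_Weyl_sum ratfun_act_Weyl_map ratfun_act_monomial_times)
    (simp add: ratfun_act_def monomial_op_sum monomial_op_const sum_distrib_left mult.assoc)

text \<open>The Weyl algebra acts faithfully, which reduces the ring axioms to those for operators.\<close>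

lemma ratfun_act_faithful:
  fixes P :: "'a::field_char_0 weyl"
  assumes "\<And>u. ratfun_act P u = 0"
  shows "P = 0"
proof (rule ccontr)
  assume "P \<noteq> 0"
  define p where "p = weyl_coeffs P"
  have P: "P = Weyl p"
    by (simp add: p_def weyl_coeffs_inverse)
  have "p \<noteq> 0"
    using \<open>P \<noteq> 0\<close> by (auto simp: P zero_weyl_def)
  then have ne: "Poly_Mapping.keys p \<noteq> {}" by simp
  define ord :: "exponents \<Rightarrow> nat" where "ord = (\<lambda>(a, b, c, d). c + d)"
  define m where "m = arg_min_on ord (Poly_Mapping.keys p)"
  have m: "m \<in> Poly_Mapping.keys p"
    unfolding m_def using ne by (intro arg_min_if_finite) auto
  have min: "ord m \<le> ord n" if "n \<in> Poly_Mapping.keys p" for n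
    unfolding m_def using ne that by (intro arg_min_least) auto
  obtain a b c d where m_eq: "m = (a, b, c, d)" by (cases m)
  define Q where "Q n = (case n of (a', b', c', d') \<Rightarrow>
      if c' = c \<and> d' = d then monom (monom (Poly_Mapping.lookup p n * (fact c * fact d)) a') b' else 0)" for n
  have "ratfun_const (Poly_Mapping.lookup p n) * monomial_op n (ratfun_x ^ c * ratfun_y ^ d) = to_fract (Q n)"
    if n: "n \<in> Poly_Mapping.keys p" for n
  proof (cases n)
    case (fields a' b' c' d')
    have const: "ratfun_dx (of_nat k :: 'a poly poly fract) = 0" for k
      using ratfun_deriv_simps(3)[of "of_nat k"] by simp
    have "(ratfun_dy ^^ d') (ratfun_x ^ c * ratfun_y ^ d :: 'a poly poly fract)
        = of_nat (fact d' * (d choose d')) * ratfun_y ^ (d - d') * ratfun_x ^ c"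
      by (simp add: dy.iter_mult_const dy.D_power_const dy.iter_power mult_ac)
    moreover have "(ratfun_dx ^^ c') (of_nat (fact d' * (d choose d')) * ratfun_y ^ (d - d') * ratfun_x ^ c :: 'a poly poly fract)
        = of_nat (fact d' * (d choose d')) * ratfun_y ^ (d - d')
          * (of_nat (fact c' * (c choose c')) * ratfun_x ^ (c - c'))"
      by (subst dx.iter_mult_const)
        (simp_all add: dx.D_mult dx.D_power_const const dx.iter_power del: of_nat_mult)
    ultimately have op: "monomial_op n (ratfun_x ^ c * ratfun_y ^ d :: 'a poly poly fract)
        = ratfun_x ^ a' * ratfun_y ^ b' * (of_nat (fact d' * (d choose d')) * ratfun_y ^ (d - d')
          * (of_nat (fact c' * (c choose c')) * ratfun_x ^ (c - c')))"
      by (simp only: fields monomial_op.simps)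
    show ?thesis
    proof (cases "c' = c \<and> d' = d")
      case True
      have eq: "ratfun_const (Poly_Mapping.lookup p n) * monomial_op n (ratfun_x ^ c * ratfun_y ^ d)
          = ratfun_const (Poly_Mapping.lookup p n * of_nat (fact c * fact d)) * ratfun_x ^ a' * ratfun_y ^ b'"
        unfolding op using True by (simp add: mult_ac)
      show ?thesis
        unfolding eq ratfun_monom using True by (simp add: Q_def fields)
    next
      case False
      then have "c < c' \<or> d < d'"
        using min[OF n] by (auto simp: ord_def m_eq fields)
      then have "(c choose c') = 0 \<or> (d choose d') = 0"
        by (auto simp: binomial_eq_0)
      then have "ratfun_const (Poly_Mapping.lookup p n) * monomial_op n (ratfun_x ^ c * ratfun_y ^ d) = 0"
        unfolding op by (elim disjE) (simp_all only: mult_zero_left mult_zero_right of_nat_0)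
      moreover have "Q n = 0"
        unfolding Q_def fields prod.case using False by auto
      ultimately show ?thesis by simp
    qed
  qed
  then have "ratfun_act P (ratfun_x ^ c * ratfun_y ^ d) = (\<Sum>n\<in>Poly_Mapping.keys p. to_fract (Q n))"
    by (simp add: ratfun_act_def P)
  also have "\<dots> = to_fract (\<Sum>n\<in>Poly_Mapping.keys p. Q n)"
    using sum_comp_morphism[of to_fract Q "Poly_Mapping.keys p"] by (simp add: o_def)
  finally have "(\<Sum>n\<in>Poly_Mapping.keys p. Q n) = 0"
    using assms by (metis to_fract_eq_0_iff)
  then have "0 = coeff (coeff (\<Sum>n\<in>Poly_Mapping.keys p. Q n) b) a" by simp
  also have "\<dots> = (\<Sum>n\<in>Poly_Mapping.keys p. if n = m then Poly_Mapping.lookup p m * (fact c * fact d) else 0)"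
    unfolding coeff_sum by (intro sum.cong) (auto simp: Q_def m_eq split: if_splits prod.splits)
  also have "\<dots> = Poly_Mapping.lookup p m * (fact c * fact d)"
    using m by simp
  finally show False
    using m by (simp add: in_keys_iff)
qed

lemma ratfun_act_minus_left: "ratfun_act (P - Q) u = ratfun_act P u - ratfun_act Q u"
proof -
  have "P = (P - Q) + Q" by transfer simp
  then show ?thesis
    using ratfun_act_add_left[of "P - Q" Q u] by simp
qed

lemma weyl_eqI:
  assumes "\<And>u. ratfun_act P u = ratfun_act Q u"
  shows "P = Q"
proof -
  have "P - Q = 0"
    using assms by (intro ratfun_act_faithful) (simp add: ratfun_act_minus_left)
  then show ?thesis by transfer simp
qed

instance weyl :: (field_char_0) ring_1
proof
  fix P Q R :: "'a weyl"
  note [simp] = ratfun_act_times ratfun_act_add_left ratfun_act_add_right ratfun_act_1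
  show "P + Q + R = P + (Q + R)" by transfer (simp add: add.assoc)
  show "P + Q = Q + P" by transfer (simp add: add.commute)
  show "0 + P = P" by transfer simp
  show "- P + P = 0" by transfer simp
  show "P - Q = P + - Q" by transfer simp
  show "P * Q * R = P * (Q * R)" by (rule weyl_eqI) simp
  show "1 * P = P" by (rule weyl_eqI) simp
  show "P * 1 = P" by (rule weyl_eqI) simp
  show "(P + Q) * R = P * R + Q * R" by (rule weyl_eqI) simp
  show "P * (Q + R) = P * Q + P * R" by (rule weyl_eqI) simp
  show "(0 :: 'a weyl) \<noteq> 1" by transfer (metis lookup_single_eq lookup_zero zero_neq_one)
qed

section \<open>Modules over the Weyl algebra, and their multiplicity\<close>

text \<open>
  A left module whose underlying set is a whole type. The notions below concern its submodules \<open>N\<close>,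
  given as sets.
\<close>

locale weyl_module =
  fixes act :: "'a::field_char_0 weyl \<Rightarrow> 'v::ab_group_add \<Rightarrow> 'v"
  assumes act_add_left: "act (P + Q) u = act P u + act Q u"
    and act_add_right: "act P (u + v) = act P u + act P v"
    and act_1: "act 1 u = u"
    and act_times: "act (P * Q) u = act P (act Q u)"

interpretation ratfun: weyl_module ratfun_act
  by standard (rule ratfun_act_add_left ratfun_act_add_right ratfun_act_1 ratfun_act_times)+

definition weyl_const :: "'a::field_char_0 \<Rightarrow> 'a weyl" where
  "weyl_const k = Weyl (Poly_Mapping.single (0, 0, 0, 0) k)"

lemma weyl_const_add: "weyl_const (k + l) = weyl_const k + weyl_const l"
  by (simp add: weyl_const_def plus_weyl.abs_eq single_add)

lemma weyl_const_mult: "weyl_const (k * l) = weyl_const k * weyl_const l"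
  by (rule weyl_eqI)
    (simp add: weyl_const_def ratfun_act_times ratfun_act_Weyl_single mult.assoc)

lemma weyl_const_1: "weyl_const 1 = 1"
  by (simp add: weyl_const_def one_weyl_def)

definition K_dim :: "('a::field_char_0 weyl \<Rightarrow> 'v::ab_group_add \<Rightarrow> 'v) \<Rightarrow> 'v set \<Rightarrow> nat" where
  "K_dim act S = vector_space.dim (\<lambda>k. act (weyl_const k)) S"

lemma (in weyl_module) vector_space_act: "vector_space (\<lambda>k. act (weyl_const k))"
  by standard
    (simp_all add: act_add_left act_add_right act_1 weyl_const_add weyl_const_mult weyl_const_1
      flip: act_times)

definition bernstein_filtration :: "int \<Rightarrow> 'a::field_char_0 weyl set" where
  "bernstein_filtration k =
     {P. \<forall>(a, b, c, d) \<in> Poly_Mapping.keys (weyl_coeffs P). int (a + b + c + d) \<le> k}"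

definition generates ::
    "('a::field_char_0 weyl \<Rightarrow> 'v::ab_group_add \<Rightarrow> 'v) \<Rightarrow> 'v list \<Rightarrow> 'v set \<Rightarrow> bool" where
  "generates act us N \<longleftrightarrow> N = {\<Sum>i<length us. act (P i) (us ! i) | P. True}"

definition good_bernstein_filtration ::
    "('a::field_char_0 weyl \<Rightarrow> 'v::ab_group_add \<Rightarrow> 'v) \<Rightarrow> 'v set \<Rightarrow> (int \<Rightarrow> 'v set) \<Rightarrow> bool" where
  "good_bernstein_filtration act N F \<longleftrightarrow>
     (\<exists>us ks. length ks = length us \<and> generates act us N \<and>
        (\<forall>k. F k = {\<Sum>i<length us. act (P i) (us ! i) | P.
                    \<forall>i<length us. P i \<in> bernstein_filtration (k - ks ! i)}))"

text \<open>
  The description ranges over all good filtrations of \<open>N\<close>, since the multiplicity does not depend on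
  the choice; it determines a number only if \<open>N\<close> is a finitely generated submodule.
\<close>

definition bernstein_multiplicity :: "('a::field_char_0 weyl \<Rightarrow> 'v::ab_group_add \<Rightarrow> 'v) \<Rightarrow> 'v set \<Rightarrow> rat" where
  "bernstein_multiplicity act N =
     (THE e. \<exists>F h. good_bernstein_filtration act N F \<and>
        (\<forall>\<^sub>F k in at_top. of_nat (K_dim act (F k)) = poly h (of_int k)) \<and>
        e = fact (degree h) * lead_coeff h)"

text \<open>K[x,y,1/f] as a subset of K(x,y).\<close>

definition poly_localization :: "'a::field_char_0 poly poly \<Rightarrow> 'a poly poly fract set" where
  "poly_localization f = {to_fract p / to_fract f ^ n | p n. True}"

lemma poly_localization_submodule:
  assumes f: "f \<noteq> 0" and u: "u \<in> poly_localization f"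
  shows "ratfun_act P u \<in> poly_localization f"
proof -
  let ?L = "poly_localization f"
  have poly: "to_fract p \<in> ?L" for p
  proof -
    have "to_fract p = to_fract p / to_fract f ^ 0" by simp
    then show ?thesis unfolding poly_localization_def by blast
  qed
  have add: "v + w \<in> ?L" if "v \<in> ?L" "w \<in> ?L" for v w
  proof -
    from that obtain p q m n where "v = to_fract p / to_fract f ^ m" "w = to_fract q / to_fract f ^ n"
      by (auto simp: poly_localization_def)
    then have "v + w = to_fract (p * f ^ n + q * f ^ m) / to_fract f ^ (m + n)"
      using f by (simp add: add_frac_eq power_add to_fract_power)
    then show ?thesis unfolding poly_localization_def by blast
  qed
  have mult: "v * w \<in> ?L" if "v \<in> ?L" "w \<in> ?L" for v w
  proof -
    from that obtain p q m n where "v = to_fract p / to_fract f ^ m" "w = to_fract q / to_fract f ^ n"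
      by (auto simp: poly_localization_def)
    then have "v * w = to_fract (p * q) / to_fract f ^ (m + n)"
      by (simp add: power_add)
    then show ?thesis unfolding poly_localization_def by blast
  qed
  have power: "v ^ n \<in> ?L" if "v \<in> ?L" for v n
    using poly[of 1] by (induction n) (simp_all add: mult that)
  have deriv: "fract_deriv D v \<in> ?L" if D: "derivation D" and "v \<in> ?L" for D v
  proof -
    from that obtain p n where "v = to_fract p / to_fract f ^ n"
      by (auto simp: poly_localization_def)
    then have "v = Fract p (f ^ n)"
      by (simp only: Fract_conv_to_fract to_fract_power)
    then have "fract_deriv D v = Fract (D p * f ^ n - p * D (f ^ n)) (f ^ (n + n))"
      using fract_deriv_Fract[OF D power_not_zero[OF f], of p n] by (simp only: power_add)
    then have "fract_deriv D v = to_fract (D p * f ^ n - p * D (f ^ n)) / to_fract f ^ (n + n)"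
      by (simp only: Fract_conv_to_fract to_fract_power)
    then show ?thesis unfolding poly_localization_def by blast
  qed
  have iter: "(ratfun_dx ^^ n) v \<in> ?L" "(ratfun_dy ^^ n) v \<in> ?L" if "v \<in> ?L" for n v
    using that
    by (induction n) (auto simp: ratfun_dx_def ratfun_dy_def deriv derivation_poly_dx derivation_poly_dy)
  have "monomial_op m u \<in> ?L" for m
    by (cases m)
      (simp, intro mult power iter u; simp add: ratfun_x_def ratfun_y_def poly)
  then have "ratfun_const k * monomial_op m u \<in> ?L" for k m
    by (intro mult) (simp_all add: ratfun_const_def poly)
  moreover have sum_mem: "(\<Sum>i\<in>A. g i) \<in> ?L" if "\<And>i. g i \<in> ?L" for g :: "exponents \<Rightarrow> _" and A
    using poly[of 0] by (induction A rule: infinite_finite_induct) (simp_all add: add that)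
  ultimately show ?thesis
    unfolding ratfun_act_def by (intro sum_mem)
qed

end

theory Submission
  imports Defs
begin

text \<open>
  The multiplicity is read off from one explicit good filtration whose dimensions can be counted.

  Choose names \<open>X, Y\<close> for the two coordinates so that \<open>f = X ^ m + Y ^ l + 1\<close> with \<open>m \<le> l\<close>, and put
  \<open>g = 1 / f\<close>. Since \<open>Y ^ l * g = 1 - X ^ m * g - g\<close>, the localization \<open>K[X, Y, g]\<close> has the K-basis
  formed by the polynomials \<open>X ^ i * Y ^ j\<close> and, for \<open>n \<ge> 0\<close> and \<open>j < l\<close>, by the elements
  \<open>X ^ i * Y ^ j * g ^ (n + 1)\<close>. Let \<open>G k\<close> be the span of the polynomials of degree at most \<open>k\<close>
  together with those \<open>X ^ i * Y ^ j * g ^ (n + 1)\<close> for which \<open>n \<le> k\<close> and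
  \<open>l * i + m * j \<le> l * (k - n) + m * (l - 1) * n\<close>. Here \<open>X\<close> and \<open>Y\<close> carry the weights \<open>l\<close> and \<open>m\<close>, in
  proportion to their pole orders at infinity on the curve \<open>f = 0\<close>; a multiplication raises the weight
  by at most \<open>l\<close>, and a derivative that raises the pole order along the curve by one raises the weight
  by at most \<open>m * (l - 1)\<close>, the weight of \<open>dY f = l * Y ^ (l - 1)\<close>.

  These bounds make the operators \<open>X, Y, dX, dY\<close> map \<open>G k\<close> into \<open>G (k + 1)\<close> (lemma \<open>G_stable\<close>).
  Conversely they produce all of \<open>G (k + 1)\<close> from \<open>G k\<close> once \<open>k \<ge> m + 2\<close> (lemma \<open>G_generated\<close>). The only
  delicate part is the new pole order \<open>k + 2\<close>, where elements of large weight are derivatives because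
  \<open>Y ^ l = f - 1 - X ^ m\<close>, and elements of small weight are derivatives because the curve is smooth:
  \<open>1 = f - X * X ^ (m - 1) - Y * Y ^ (l - 1)\<close> writes the unit through \<open>f\<close>, \<open>dX f\<close> and \<open>dY f\<close>. So \<open>G\<close> agrees,
  for large \<open>k\<close>, with the good filtration generated by a basis of \<open>G (m + 2)\<close>.

  The spanning elements of \<open>G k\<close> are independent (lemma \<open>e_independent\<close>), so \<open>dim (G k)\<close> counts exponents.
  The polynomials contribute \<open>k ^ 2 / 2\<close> to leading order, and the pole order \<open>n + 1\<close> contributes
  \<open>l * (k - n) + m * (l - 1) * n\<close> up to an additive constant, so that the sum over \<open>n \<le> k\<close> is
  \<open>(l + m * (l - 1)) * k ^ 2 / 2\<close>. Multiplying the total by \<open>2!\<close> gives \<open>l * m + (l - m) + 1\<close>.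

  That any other good filtration yields the same number follows from the usual comparison: two good
  filtrations contain each other up to a shift (lemma \<open>good_filtrations_comparable\<close>), hence their
  Hilbert polynomials agree in degree and leading coefficient.
\<close>

section \<open>The Bernstein filtration of the Weyl algebra\<close>

lemma Weyl_in_bernstein_filtration:
  "Weyl p \<in> bernstein_filtration k \<longleftrightarrow>
     (\<forall>(a, b, c, d) \<in> Poly_Mapping.keys p. int (a + b + c + d) \<le> k)"
  by (simp add: bernstein_filtration_def)

lemma bernstein_filtration_0: "0 \<in> bernstein_filtration k"
  by (simp add: zero_weyl_def Weyl_in_bernstein_filtration)

lemma bernstein_filtration_add:
  assumes "P \<in> bernstein_filtration k" "Q \<in> bernstein_filtration k"
  shows "P + Q \<in> bernstein_filtration k"
  using assms Poly_Mapping.keys_add[of "weyl_coeffs P" "weyl_coeffs Q"]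
  by (fastforce simp: bernstein_filtration_def plus_weyl.rep_eq)

lemma bernstein_filtration_sum:
  "(\<And>i. i \<in> A \<Longrightarrow> P i \<in> bernstein_filtration k) \<Longrightarrow> (\<Sum>i\<in>A. P i) \<in> bernstein_filtration k"
  by (induction A rule: infinite_finite_induct)
    (simp_all add: bernstein_filtration_0 bernstein_filtration_add)

lemma bernstein_filtration_mono: "k \<le> k' \<Longrightarrow> bernstein_filtration k \<subseteq> bernstein_filtration k'"
  by (fastforce simp: bernstein_filtration_def)

lemma Weyl_sum: "Weyl (\<Sum>i\<in>A. p i) = (\<Sum>i\<in>A. Weyl (p i))"
  by (induction A rule: infinite_finite_induct)
    (simp_all add: zero_weyl_def flip: plus_weyl.abs_eq)

text \<open>
  Normal ordering of a product of two monomials replaces a pair \<open>dx\<close>, \<open>x\<close> by \<open>1\<close>, which lowers the degree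
  by two; so no term of \<open>monomial_times\<close> exceeds the sum of the degrees.
\<close>

lemma bernstein_filtration_mult:
  fixes P Q :: "'a::field_char_0 weyl"
  assumes "P \<in> bernstein_filtration k" "Q \<in> bernstein_filtration k'"
  shows "P * Q \<in> bernstein_filtration (k + k')"
proof -
  define p q where "p = weyl_coeffs P" and "q = weyl_coeffs Q"
  have PQ: "P * Q = (\<Sum>m\<in>Poly_Mapping.keys p. \<Sum>n\<in>Poly_Mapping.keys q.
     Weyl (Poly_Mapping.map ((*) (Poly_Mapping.lookup p m * Poly_Mapping.lookup q n)) (monomial_times m n)))"
    by (simp add: times_weyl_def p_def q_def Weyl_sum)
  have "Weyl (Poly_Mapping.map ((*) s) (monomial_times m n)) \<in> bernstein_filtration (k + k')"
    if mn: "m \<in> Poly_Mapping.keys p" "n \<in> Poly_Mapping.keys q" for m n and s :: 'a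
  proof -
    obtain a b c d a' b' c' d' where m: "m = (a, b, c, d)" and n: "n = (a', b', c', d')"
      by (metis prod_cases4)
    have le: "int (a + b + c + d) \<le> k" "int (a' + b' + c' + d') \<le> k'"
      using assms mn by (auto simp: bernstein_filtration_def p_def q_def m n)
    have "Poly_Mapping.keys (Poly_Mapping.map ((*) s) (monomial_times m n))
        \<subseteq> Poly_Mapping.keys (monomial_times m n :: _ \<Rightarrow>\<^sub>0 'a)"
      by (auto simp: in_keys_iff Poly_Mapping.map.rep_eq when_def split: if_splits)
    moreover have "Weyl (monomial_times m n :: _ \<Rightarrow>\<^sub>0 'a) \<in> bernstein_filtration (k + k')"
      unfolding m n monomial_times.simps Weyl_sum
      by (intro bernstein_filtration_sum)
        (use le in \<open>auto simp: Weyl_in_bernstein_filtration split: if_splits\<close>)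
    ultimately show ?thesis
      unfolding Weyl_in_bernstein_filtration by blast
  qed
  then show ?thesis
    unfolding PQ by (intro bernstein_filtration_sum) auto
qed

lemma bernstein_filtration_exhaustive: "\<exists>k. P \<in> bernstein_filtration (int k)"
proof -
  define S where "S = (\<lambda>(a, b, c, d). a + b + c + d) ` Poly_Mapping.keys (weyl_coeffs P)"
  have "finite S" by (simp add: S_def)
  then have "a + b + c + d \<le> Max S"
    if "(a, b, c, d) \<in> Poly_Mapping.keys (weyl_coeffs P)" for a b c d
    using that by (intro Max_ge) (force simp: S_def)+
  then have "P \<in> bernstein_filtration (int (Max S))"
    unfolding bernstein_filtration_def by (auto simp flip: of_nat_add)
  then show ?thesis ..
qed

lemma finite_exponents_bounded: "finite {(a, b, c, d). int (a + b + c + d) \<le> k}"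
proof (rule finite_subset)
  show "{(a, b, c, d). int (a + b + c + d) \<le> k}
      \<subseteq> {..nat k} \<times> {..nat k} \<times> {..nat k} \<times> {..nat k}"
    by auto
qed auto

lemma Weyl_single_scale: "Weyl (Poly_Mapping.single m k) = weyl_const k * Weyl (Poly_Mapping.single m 1)"
  by (rule weyl_eqI)
    (cases m, simp add: weyl_const_def ratfun_act_times ratfun_act_Weyl_single)

lemma weyl_eq_sum_monomials:
  "P = (\<Sum>m\<in>Poly_Mapping.keys (weyl_coeffs P).
     weyl_const (Poly_Mapping.lookup (weyl_coeffs P) m) * Weyl (Poly_Mapping.single m 1))"
proof -
  have "P = Weyl (weyl_coeffs P)"
    by (simp add: weyl_coeffs_inverse)
  also have "weyl_coeffs P = (\<Sum>m\<in>Poly_Mapping.keys (weyl_coeffs P).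
      Poly_Mapping.single m (Poly_Mapping.lookup (weyl_coeffs P) m))"
    by (rule poly_mapping_eqI)
      (auto simp: lookup_sum lookup_single when_def in_keys_iff
        intro: sum.neutral split: if_splits)
  finally show ?thesis
    by (simp only: Weyl_sum Weyl_single_scale[of _ "Poly_Mapping.lookup (weyl_coeffs P) _"])
qed

section \<open>Comparison of good filtrations\<close>

context weyl_module
begin

sublocale K: vector_space "\<lambda>k. act (weyl_const k)"
  by (rule vector_space_act)

lemma act_0_left [simp]: "act 0 u = 0"
  using act_add_left[of 0 0 u] by simp

lemma act_0_right [simp]: "act P 0 = 0"
  using act_add_right[of P 0 0] by simp

lemma act_sum_left: "act (\<Sum>i\<in>A. P i) u = (\<Sum>i\<in>A. act (P i) u)"
  by (induction A rule: infinite_finite_induct) (simp_all add: act_add_left)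

lemma act_sum_right: "act P (\<Sum>i\<in>A. u i) = (\<Sum>i\<in>A. act P (u i))"
  by (induction A rule: infinite_finite_induct) (simp_all add: act_add_right)

lemma good_filtration_finite_dim:
  assumes "good_bernstein_filtration act N F"
  obtains B where "finite B" "F k \<subseteq> K.span B"
proof -
  obtain us ks where F: "F k = {\<Sum>i<length us. act (P i) (us ! i) | P.
      \<forall>i<length us. P i \<in> bernstein_filtration (k - ks ! i)}"
    using assms unfolding good_bernstein_filtration_def by blast
  define B where "B = (\<Union>i<length us. (\<lambda>m. act (Weyl (Poly_Mapping.single m 1)) (us ! i)) `
      {(a, b, c, d). int (a + b + c + d) \<le> k - ks ! i})"
  have "act P (us ! i) \<in> K.span B"
    if i: "i < length us" and P: "P \<in> bernstein_filtration (k - ks ! i)" for P i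
  proof -
    have "act P (us ! i) = (\<Sum>m\<in>Poly_Mapping.keys (weyl_coeffs P).
        act (weyl_const (Poly_Mapping.lookup (weyl_coeffs P) m))
          (act (Weyl (Poly_Mapping.single m 1)) (us ! i)))"
      by (subst weyl_eq_sum_monomials) (simp only: act_sum_left act_times)
    also have "\<dots> \<in> K.span B"
      using i P by (intro K.span_sum K.span_scale K.span_base)
        (fastforce simp: B_def bernstein_filtration_def)
    finally show ?thesis .
  qed
  then have "F k \<subseteq> K.span B"
    unfolding F by (auto intro!: K.span_sum)
  moreover have "finite B"
    unfolding B_def by (intro finite_UN_I finite_imageI finite_exponents_bounded) simp
  ultimately show thesis by (rule that[rotated])
qed

text \<open>
  Write the generators of \<open>F\<close> as combinations of those of \<open>F'\<close>. The finitely many coefficients have bounded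
  degree, so multiplicativity of the Bernstein filtration turns this into a uniform shift.
\<close>

lemma good_filtrations_comparable:
  assumes "good_bernstein_filtration act N F" "good_bernstein_filtration act N F'"
  shows "\<exists>c. \<forall>k. F k \<subseteq> F' (k + c)"
proof -
  obtain us ks where us: "generates act us N"
    and F: "\<And>k. F k = {\<Sum>i<length us. act (P i) (us ! i) | P.
      \<forall>i<length us. P i \<in> bernstein_filtration (k - ks ! i)}"
    using assms(1) unfolding good_bernstein_filtration_def by blast
  obtain vs ls where vs: "generates act vs N"
    and F': "\<And>k. F' k = {\<Sum>i<length vs. act (P i) (vs ! i) | P.
      \<forall>i<length vs. P i \<in> bernstein_filtration (k - ls ! i)}"
    using assms(2) unfolding good_bernstein_filtration_def by blast
  have "\<exists>Q. us ! i = (\<Sum>j<length vs. act (Q j) (vs ! j))" if "i < length us" for i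
  proof -
    have "us ! i = (\<Sum>j<length us. act (if j = i then 1 else 0) (us ! j))"
      using that by (simp add: act_1 if_distrib[of "\<lambda>P. act P _"] cong: if_cong)
    then have "us ! i \<in> N"
      using us unfolding generates_def by (auto intro: exI[of _ "\<lambda>j. if j = i then 1 else 0"])
    then show ?thesis
      using vs unfolding generates_def by blast
  qed
  then obtain Q where Q: "\<And>i. i < length us \<Longrightarrow> us ! i = (\<Sum>j<length vs. act (Q i j) (vs ! j))"
    by metis
  have "\<forall>i j. \<exists>k. Q i j \<in> bernstein_filtration (int k)"
    using bernstein_filtration_exhaustive by blast
  then obtain q where q: "\<And>i j. Q i j \<in> bernstein_filtration (int (q i j))"
    by metis
  define S where "S = (\<lambda>(i, j). int (q i j) - ks ! i + ls ! j) ` ({..<length us} \<times> {..<length vs})"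
  define c where "c = Max (insert 0 S)"
  have c: "int (q i j) - ks ! i + ls ! j \<le> c" if "i < length us" "j < length vs" for i j
    unfolding c_def using that by (intro Max_ge) (auto simp: S_def)
  have "F k \<subseteq> F' (k + c)" for k
  proof
    fix u assume "u \<in> F k"
    then obtain P where u: "u = (\<Sum>i<length us. act (P i) (us ! i))"
      and P: "\<And>i. i < length us \<Longrightarrow> P i \<in> bernstein_filtration (k - ks ! i)"
      unfolding F by blast
    define R where "R j = (\<Sum>i<length us. P i * Q i j)" for j
    have "u = (\<Sum>i<length us. \<Sum>j<length vs. act (P i) (act (Q i j) (vs ! j)))"
      unfolding u using Q by (intro sum.cong refl) (simp flip: act_sum_right)
    also have "\<dots> = (\<Sum>j<length vs. act (R j) (vs ! j))"
      by (subst sum.swap) (simp add: R_def act_sum_left act_times)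
    finally have "u = (\<Sum>j<length vs. act (R j) (vs ! j))" .
    moreover have "R j \<in> bernstein_filtration (k + c - ls ! j)" if j: "j < length vs" for j
      unfolding R_def
    proof (rule bernstein_filtration_sum)
      fix i assume "i \<in> {..<length us}"
      then show "P i * Q i j \<in> bernstein_filtration (k + c - ls ! j)"
        using bernstein_filtration_mult[OF P[of i] q[of i j]] c[of i j] j
          bernstein_filtration_mono[of "k - ks ! i + int (q i j)" "k + c - ls ! j"]
        by auto
    qed
    ultimately show "u \<in> F' (k + c)"
      unfolding F' by blast
  qed
  then show ?thesis by (intro exI allI)
qed

text \<open>
  The finite spanning set matters, since the dimension of an infinite-dimensional space is \<open>0\<close> by
  convention.
\<close>

lemma K_dim_mono:
  assumes "finite B" "W \<subseteq> K.span B" "V \<subseteq> W"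
  shows "K_dim act V \<le> K_dim act W"
proof -
  obtain BV where BV: "BV \<subseteq> V" "K.independent BV" "card BV = K.dim V"
    by (rule K.basis_exists)
  obtain BW where BW: "BW \<subseteq> W" "K.independent BW" "W \<subseteq> K.span BW" "card BW = K.dim W"
    by (rule K.basis_exists)
  have "finite BW"
    using K.independent_span_bound[OF assms(1) BW(2)] BW(1) assms(2) by blast
  then have "card BV \<le> card BW"
    using K.independent_span_bound[of BW BV] BV BW assms(3) by blast
  then show ?thesis
    using BV BW by (simp add: K_dim_def)
qed

lemma good_filtrations_K_dim_le:
  assumes "good_bernstein_filtration act N F" "good_bernstein_filtration act N F'"
  shows "\<exists>c. \<forall>k. K_dim act (F k) \<le> K_dim act (F' (k + c))"
  by (meson assms good_filtrations_comparable good_filtration_finite_dim K_dim_mono)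

end

section \<open>Independence of the multiplicity\<close>

text \<open>
  A positive lower bound, rather than mere positivity, is what survives the induction step, in which
  the value is multiplied by the argument and shifted by the constant term.
\<close>

lemma poly_ge_lead_coeff_at_infinity:
  fixes p :: "'b::linordered_field poly"
  assumes "lead_coeff p > 0"
  shows "\<exists>z. \<forall>x\<ge>z. poly p x \<ge> lead_coeff p"
  using assms
proof (induction p)
  case (pCons a p)
  show ?case
  proof (cases "p = 0")
    case False
    define c where "c = lead_coeff p"
    have c: "c > 0" "lead_coeff (pCons a p) = c"
      using pCons.prems False by (simp_all add: c_def)
    then obtain z where z: "\<And>x. x \<ge> z \<Longrightarrow> poly p x \<ge> c"
      using pCons c_def by auto
    have "poly (pCons a p) x \<ge> c" if "x \<ge> max z (max 0 ((c - a) / c))" for x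
    proof -
      have "c \<le> a + x * c"
        using that c(1) by (simp add: field_simps)
      also have "\<dots> \<le> a + x * poly p x"
        using that z[of x] by (simp add: mult_left_mono)
      finally show ?thesis by simp
    qed
    then show ?thesis
      unfolding c(2) by blast
  qed simp
qed simp

lemma lead_coeff_nonneg:
  fixes p :: "rat poly"
  assumes "\<forall>\<^sub>F k in at_top. poly p (of_int k) \<ge> 0"
  shows "lead_coeff p \<ge> 0"
proof (rule ccontr)
  assume neg: "\<not> lead_coeff p \<ge> 0"
  then obtain z where z: "\<And>x. x \<ge> z \<Longrightarrow> poly (- p) x \<ge> lead_coeff (- p)"
    using poly_ge_lead_coeff_at_infinity[of "- p"] by auto
  have "\<forall>\<^sub>F k in at_top. of_int k \<ge> z"
    using eventually_ge_at_top[of "\<lceil>z\<rceil>"] by (simp add: ceiling_le_iff)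
  with assms have "\<forall>\<^sub>F k :: int in at_top. False"
    by eventually_elim (use z neg in fastforce)
  then show False by simp
qed

text \<open>
  Nonnegativity of \<open>p\<close> excludes a polynomial of larger degree that stays below \<open>q\<close> by tending to minus infinity.
\<close>

lemma eventually_le_imp_degree_le:
  fixes p q :: "rat poly"
  assumes "\<forall>\<^sub>F k in at_top. 0 \<le> poly p (of_int k)"
    and "\<forall>\<^sub>F k in at_top. poly p (of_int k) \<le> poly q (of_int k)"
  shows "degree p \<le> degree q"
    and "degree p = degree q \<Longrightarrow> lead_coeff p \<le> lead_coeff q"
proof -
  have p: "lead_coeff p \<ge> 0"
    by (rule lead_coeff_nonneg[OF assms(1)])
  have d: "lead_coeff (q - p) \<ge> 0"
    by (rule lead_coeff_nonneg) (use assms(2) in simp)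
  show le: "degree p \<le> degree q"
  proof (rule ccontr)
    assume gt: "\<not> degree p \<le> degree q"
    then have "degree (q - p) = degree p"
      using degree_add_eq_right[of q "- p"] by simp
    with gt d have "lead_coeff p \<le> 0"
      by (simp add: coeff_eq_0)
    with p have "p = 0" by simp
    with gt show False by simp
  qed
  show "lead_coeff p \<le> lead_coeff q" if eq: "degree p = degree q"
  proof (rule ccontr)
    assume gt: "\<not> lead_coeff p \<le> lead_coeff q"
    then have ne: "coeff (q - p) (degree p) < 0"
      using eq by simp
    then have "degree (q - p) \<ge> degree p"
      by (intro le_degree) simp
    then have "degree (q - p) = degree p"
      using degree_diff_le[of q "degree p" p] eq by simp
    with ne d show False by simp
  qed
qed

lemma eventually_shift_int:
  assumes "\<forall>\<^sub>F k :: int in at_top. P k"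
  shows "\<forall>\<^sub>F k in at_top. P (k + c)"
proof -
  obtain z where "\<And>k. k \<ge> z \<Longrightarrow> P k"
    using assms by (auto simp: eventually_at_top_linorder)
  then show ?thesis
    by (auto simp: eventually_at_top_linorder intro!: exI[of _ "z - c"])
qed

text \<open>
  Substituting \<open>k + c\<close> for \<open>k\<close> changes neither the degree nor the leading coefficient of a polynomial, so the
  shift between two good filtrations is invisible to the multiplicity.
\<close>

lemma (in weyl_module) hilbert_polynomial_le:
  fixes h h' :: "rat poly"
  assumes F: "good_bernstein_filtration act N F" "good_bernstein_filtration act N F'"
    and h: "\<forall>\<^sub>F k in at_top. of_nat (K_dim act (F k)) = poly h (of_int k)"
    and h': "\<forall>\<^sub>F k in at_top. of_nat (K_dim act (F' k)) = poly h' (of_int k)"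
  shows "degree h \<le> degree h'"
    and "degree h = degree h' \<Longrightarrow> lead_coeff h \<le> lead_coeff h'"
proof -
  obtain c where c: "\<And>k. K_dim act (F k) \<le> K_dim act (F' (k + c))"
    using good_filtrations_K_dim_le[OF F] by blast
  define q where "q = h' \<circ>\<^sub>p [:of_int c, 1:]"
  have q: "degree q = degree h'" "lead_coeff q = lead_coeff h'"
    unfolding q_def using lead_coeff_comp[of "[:of_int c, 1:]" h'] by (simp_all add: degree_pcompose)
  have nonneg: "\<forall>\<^sub>F k in at_top. 0 \<le> poly h (of_int k)"
    using h by eventually_elim (metis of_nat_0_le_iff)
  have le: "\<forall>\<^sub>F k in at_top. poly h (of_int k) \<le> poly q (of_int k)"
    using h eventually_shift_int[OF h', of c]
  proof eventually_elim
    case (elim k)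
    have "of_nat (K_dim act (F k)) \<le> (of_nat (K_dim act (F' (k + c))) :: rat)"
      using c by simp
    then show ?case
      unfolding elim by (simp add: q_def poly_pcompose add.commute)
  qed
  show "degree h \<le> degree h'"
    and "degree h = degree h' \<Longrightarrow> lead_coeff h \<le> lead_coeff h'"
    using eventually_le_imp_degree_le[OF nonneg le, unfolded q(2), unfolded q(1)] by blast+
qed

lemma (in weyl_module) bernstein_multiplicity_eqI:
  fixes h :: "rat poly"
  assumes "good_bernstein_filtration act N F"
    and "\<forall>\<^sub>F k in at_top. of_nat (K_dim act (F k)) = poly h (of_int k)"
  shows "bernstein_multiplicity act N = fact (degree h) * lead_coeff h"
  unfolding bernstein_multiplicity_def
proof (rule the_equality)
  fix e :: rat assume "\<exists>F h. good_bernstein_filtration act N F \<and>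
    (\<forall>\<^sub>F k in at_top. of_nat (K_dim act (F k)) = poly h (of_int k)) \<and> e = fact (degree h) * lead_coeff h"
  then obtain F' h' where F': "good_bernstein_filtration act N F'"
    "\<forall>\<^sub>F k in at_top. of_nat (K_dim act (F' k)) = poly h' (of_int k)"
    and e: "e = fact (degree h') * lead_coeff h'"
    by blast
  note le = hilbert_polynomial_le[OF assms(1) F'(1) assms(2) F'(2)]
    hilbert_polynomial_le[OF F'(1) assms(1) F'(2) assms(2)]
  from le have "degree h' = degree h" by simp
  with le have "lead_coeff h' = lead_coeff h" by simp
  with \<open>degree h' = degree h\<close> show "e = fact (degree h) * lead_coeff h"
    by (simp add: e)
qed (use assms in blast)

section \<open>A criterion for computing multiplicities\<close>

lemma ratfun_act_weyl_const [simp]: "ratfun_act (weyl_const k) u = ratfun_const k * u"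
  by (simp add: weyl_const_def ratfun_act_Weyl_single)

lemma weyl_const_in_bernstein_filtration: "weyl_const k \<in> bernstein_filtration 0"
  by (simp add: weyl_const_def Weyl_in_bernstein_filtration)

lemma monomial_in_bernstein_filtration:
  "a + b + c + d \<le> n \<Longrightarrow> Weyl (Poly_Mapping.single (a, b, c, d) k) \<in> bernstein_filtration (int n)"
  by (auto simp: Weyl_in_bernstein_filtration)

text \<open>
  An increasing family of subspaces compatible with the generators of the Weyl algebra. It differs from
  a good filtration in that no finite generation is demanded; the lemma \<open>multiplicity\<close> below adds that
  demand from some index on, which is where a hand-made filtration can be expected to satisfy it.
\<close>

locale bernstein_exhaustion =
  fixes G :: "nat \<Rightarrow> 'a::field_char_0 poly poly fract set"
  assumes subspace: "ratfun.K.subspace (G k)"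
    and G_Suc: "u \<in> G k \<Longrightarrow> u \<in> G (Suc k)"
    and G_x: "u \<in> G k \<Longrightarrow> ratfun_x * u \<in> G (Suc k)"
    and G_y: "u \<in> G k \<Longrightarrow> ratfun_y * u \<in> G (Suc k)"
    and G_dx: "u \<in> G k \<Longrightarrow> ratfun_dx u \<in> G (Suc k)"
    and G_dy: "u \<in> G k \<Longrightarrow> ratfun_dy u \<in> G (Suc k)"
begin

lemma G_mono:
  assumes "u \<in> G k" "k \<le> k'"
  shows "u \<in> G k'"
  using assms(2,1) by (induction k' rule: dec_induct) (auto intro: G_Suc)

lemma monomial_op_G:
  assumes "u \<in> G k"
  shows "monomial_op (a, b, c, d) u \<in> G (k + a + b + c + d)"
proof -
  have "(ratfun_dy ^^ d) u \<in> G (k + d)"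
    by (induction d) (auto simp: assms intro: G_dy)
  then have "(ratfun_dx ^^ c) ((ratfun_dy ^^ d) u) \<in> G (k + d + c)"
    by (induction c) (auto intro: G_dx)
  then have "ratfun_y ^ b * (ratfun_dx ^^ c) ((ratfun_dy ^^ d) u) \<in> G (k + d + c + b)"
    by (induction b) (auto simp: mult.assoc intro: G_y)
  then have "ratfun_x ^ a * (ratfun_y ^ b * (ratfun_dx ^^ c) ((ratfun_dy ^^ d) u)) \<in> G (k + d + c + b + a)"
    by (induction a) (auto simp: mult.assoc intro: G_x)
  then show ?thesis by (simp add: ac_simps)
qed

lemma ratfun_act_G:
  assumes u: "u \<in> G k" and P: "P \<in> bernstein_filtration (int n)"
  shows "ratfun_act P u \<in> G (k + n)"
  unfolding ratfun_act_def
proof (rule ratfun.K.subspace_sum[OF subspace])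
  fix m assume m: "m \<in> Poly_Mapping.keys (weyl_coeffs P)"
  obtain a b c d where m_eq: "m = (a, b, c, d)" by (metis prod_cases4)
  have "a + b + c + d \<le> n"
    using P m by (auto simp: bernstein_filtration_def m_eq simp flip: of_nat_add)
  then have "monomial_op m u \<in> G (k + n)"
    unfolding m_eq by (intro G_mono[OF monomial_op_G[OF u]]) simp
  then show "ratfun_const (Poly_Mapping.lookup (weyl_coeffs P) m) * monomial_op m u \<in> G (k + n)"
    using ratfun.K.subspace_scale[OF subspace] by simp
qed

text \<open>
  The hypothesis \<open>step\<close> says that \<open>G (k + 1)\<close> is generated from \<open>G k\<close> by operators of degree at most one.
  By induction \<open>G (k0 + n)\<close> is then obtained from \<open>G k0\<close> by operators of degree at most \<open>n\<close>, and so \<open>G\<close>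
  coincides from \<open>k0\<close> on with the good filtration that has the finite spanning set \<open>B\<close> of \<open>G k0\<close> as
  generators, all placed in degree \<open>k0\<close>.
\<close>

lemma multiplicity:
  fixes h :: "rat poly"
  assumes B: "finite B" "G k0 = ratfun.K.span B"
    and step: "\<And>k S. \<lbrakk>k \<ge> k0; ratfun.K.subspace S;
      \<And>u. u \<in> G k \<Longrightarrow> u \<in> S \<and> ratfun_x * u \<in> S \<and> ratfun_y * u \<in> S \<and> ratfun_dx u \<in> S \<and> ratfun_dy u \<in> S\<rbrakk>
      \<Longrightarrow> G (Suc k) \<subseteq> S"
    and dim: "\<And>k. k \<ge> k0 \<Longrightarrow> of_nat (ratfun.K.dim (G k)) = poly h (of_nat k)"
  shows "bernstein_multiplicity ratfun_act (\<Union>k. G k) = fact (degree h) * lead_coeff h"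
proof -
  obtain us where us: "set us = B"
    using finite_list[OF B(1)] by blast
  define comb where "comb P = (\<Sum>i<length us. ratfun_act (P i) (us ! i))" for P
  define H where "H n = {comb P | P. \<forall>i<length us. P i \<in> bernstein_filtration (int n)}" for n
  have us_G: "us ! i \<in> G k0" if "i < length us" for i
    using that us unfolding B(2) by (intro ratfun.K.span_base) auto
  have H_subspace: "ratfun.K.subspace (H n)" for n
  proof (rule ratfun.K.subspaceI)
    have "0 = comb (\<lambda>_. 0)"
      by (simp add: comb_def)
    then show "0 \<in> H n"
      unfolding H_def using bernstein_filtration_0 by blast
  next
    fix u v assume "u \<in> H n" "v \<in> H n"
    then obtain P Q where PQ: "u = comb P" "v = comb Q"
      "\<forall>i<length us. P i \<in> bernstein_filtration (int n)"
      "\<forall>i<length us. Q i \<in> bernstein_filtration (int n)"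
      unfolding H_def by blast
    then have "u + v = comb (\<lambda>i. P i + Q i)"
      by (simp add: comb_def ratfun_act_add_left sum.distrib)
    moreover have "\<forall>i<length us. P i + Q i \<in> bernstein_filtration (int n)"
      using PQ bernstein_filtration_add by blast
    ultimately show "u + v \<in> H n"
      unfolding H_def by blast
  next
    fix c u assume "u \<in> H n"
    then obtain P where P: "u = comb P" "\<forall>i<length us. P i \<in> bernstein_filtration (int n)"
      unfolding H_def by blast
    then have "ratfun_act (weyl_const c) u = comb (\<lambda>i. weyl_const c * P i)"
      unfolding comb_def by (simp add: ratfun_act_times sum_distrib_left)
    moreover have "\<forall>i<length us. weyl_const c * P i \<in> bernstein_filtration (int n)"
      using P bernstein_filtration_mult[OF weyl_const_in_bernstein_filtration[of c], of _ "int n"] by simp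
    ultimately show "ratfun_act (weyl_const c) u \<in> H n"
      unfolding H_def by blast
  qed
  have H_act: "ratfun_act Q u \<in> H (Suc n)"
    if Q: "Q \<in> bernstein_filtration 1" and u: "u \<in> H n" for Q u n
  proof -
    obtain P where P: "u = comb P" "\<forall>i<length us. P i \<in> bernstein_filtration (int n)"
      using u unfolding H_def by blast
    then have "ratfun_act Q u = comb (\<lambda>i. Q * P i)"
      unfolding comb_def by (simp add: ratfun_act_times ratfun.act_sum_right)
    moreover have "\<forall>i<length us. Q * P i \<in> bernstein_filtration (int (Suc n))"
      using P bernstein_filtration_mult[OF Q, of _ "int n"] by simp
    ultimately show ?thesis
      unfolding H_def by blast
  qed
  have H_G: "H n = G (k0 + n)" for n
  proof
    show "H n \<subseteq> G (k0 + n)"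
      unfolding H_def comb_def
      by (auto intro!: ratfun.K.subspace_sum[OF subspace] ratfun_act_G us_G)
    show "G (k0 + n) \<subseteq> H n"
    proof (induction n)
      case 0
      have "B \<subseteq> H 0"
      proof
        fix b assume "b \<in> B"
        then obtain i where i: "i < length us" "b = us ! i"
          using us by (metis in_set_conv_nth)
        define P :: "nat \<Rightarrow> 'a weyl" where "P j = (if j = i then 1 else 0)" for j
        have "b = comb P"
          using i by (simp add: comb_def P_def ratfun_act_1 if_distrib[of "\<lambda>P. ratfun_act P _"] cong: if_cong)
        moreover have "\<forall>j<length us. P j \<in> bernstein_filtration (int 0)"
          using weyl_const_in_bernstein_filtration[of "1 :: 'a"]
          by (simp add: P_def weyl_const_1 bernstein_filtration_0)
        ultimately show "b \<in> H 0"
          unfolding H_def by blast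
      qed
      then show ?case
        using ratfun.K.span_minimal[OF _ H_subspace] by (simp add: B(2))
    next
      case (Suc n)
      have "G (Suc (k0 + n)) \<subseteq> H (Suc n)"
      proof (rule step)
        fix u assume "u \<in> G (k0 + n)"
        then have "u \<in> H n"
          using Suc by blast
        then have op: "monomial_op (a, b, c, d) u \<in> H (Suc n)" if "a + b + c + d \<le> 1" for a b c d
          using H_act[OF monomial_in_bernstein_filtration[of a b c d 1 1, simplified]] that
          by (simp add: ratfun_act_Weyl_single del: monomial_op.simps)
        show "u \<in> H (Suc n) \<and> ratfun_x * u \<in> H (Suc n) \<and> ratfun_y * u \<in> H (Suc n) \<and>
            ratfun_dx u \<in> H (Suc n) \<and> ratfun_dy u \<in> H (Suc n)"
          using op[of 0 0 0 0] op[of 1 0 0 0] op[of 0 1 0 0] op[of 0 0 1 0] op[of 0 0 0 1] by simp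
      qed (simp_all add: H_subspace)
      then show ?case by simp
    qed
  qed
  define F where "F k = {comb P | P. \<forall>i<length us. P i \<in> bernstein_filtration (k - replicate (length us) (int k0) ! i)}" for k
  have F_G: "F (int k) = G k" if "k \<ge> k0" for k
    using that H_G[of "k - k0"] by (simp add: F_def H_def of_nat_diff cong: conj_cong)
  have "generates ratfun_act us (\<Union>k. G k)"
    unfolding generates_def comb_def[symmetric]
  proof (intro set_eqI iffI)
    fix u assume "u \<in> (\<Union>k. G k)"
    then obtain k where "u \<in> G k" by blast
    then have "u \<in> H k"
      unfolding H_G by (rule G_mono) simp
    then show "u \<in> {comb P | P. True}"
      unfolding H_def by blast
  next
    fix u assume "u \<in> {comb P | P. True}"
    then obtain P where u: "u = comb P" by blast
    have "\<forall>i. \<exists>k. P i \<in> bernstein_filtration (int k)"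
      using bernstein_filtration_exhaustive by blast
    then obtain q where q: "\<And>i. P i \<in> bernstein_filtration (int (q i))"
      by metis
    have "P i \<in> bernstein_filtration (int (\<Sum>j<length us. q j))" if "i < length us" for i
    proof -
      have "q i \<le> (\<Sum>j<length us. q j)"
        using that by (intro member_le_sum) auto
      then show ?thesis
        using q[of i] bernstein_filtration_mono[of "int (q i)"] by (meson in_mono of_nat_mono)
    qed
    then have "u \<in> H (\<Sum>j<length us. q j)"
      unfolding H_def u by blast
    then show "u \<in> (\<Union>k. G k)"
      unfolding H_G by blast
  qed
  then have "good_bernstein_filtration ratfun_act (\<Union>k. G k) F"
    unfolding good_bernstein_filtration_def F_def comb_def
    by (intro exI[of _ us] exI[of _ "replicate (length us) (int k0)"]) simp
  moreover have "\<forall>\<^sub>F k in at_top. of_nat (K_dim ratfun_act (F k)) = poly h (of_int k)"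
    using eventually_ge_at_top[of "int k0"]
  proof eventually_elim
    case (elim k)
    then obtain n where "k = int n" "n \<ge> k0"
      by (metis nat_int_comparison(3) nonneg_int_cases of_nat_0_le_iff order_trans)
    then show ?case
      using F_G[of n] dim[of n] by (simp add: K_dim_def)
  qed
  ultimately show ?thesis
    by (rule ratfun.bernstein_multiplicity_eqI)
qed

end

section \<open>Linear independence from derivatives\<close>

context derivation
begin

text \<open>
  For \<open>D = d/dY\<close> and a polynomial \<open>u\<close> in \<open>Y\<close>: the degree is at most \<open>s\<close> and \<open>c\<close> is the coefficient of \<open>Y ^ s\<close>.
  Phrasing this through derivatives makes the notion available in a field of rational functions without
  choosing which variable is the outer one of a nested polynomial.
\<close>

definition top_coeff :: "nat \<Rightarrow> 'b \<Rightarrow> 'b \<Rightarrow> bool" where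
  "top_coeff s u c \<longleftrightarrow> (D ^^ s) u = of_nat (fact s) * c \<and> (D ^^ Suc s) u = 0"

lemma top_coeff_vanish:
  assumes "top_coeff s u c" "s < i"
  shows "(D ^^ i) u = 0"
proof -
  obtain j where "i = j + Suc s"
    using assms(2) by (metis add_Suc_right add.commute less_imp_Suc_add)
  then have "(D ^^ i) u = (D ^^ j) ((D ^^ Suc s) u)"
    by (simp only: funpow_add o_apply)
  then show ?thesis
    using assms(1) by (simp only: top_coeff_def iter_0)
qed

text \<open>
  In the Leibniz formula for \<open>D ^^ (s + t)\<close> only the term that differentiates \<open>u\<close> exactly \<open>s\<close> times and \<open>v\<close>
  exactly \<open>t\<close> times survives.
\<close>

lemma top_coeff_mult:
  assumes u: "top_coeff s u c" and v: "top_coeff t v c'"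
  shows "top_coeff (s + t) (u * v) (c * c')"
proof -
  have zero: "(D ^^ i) u * (D ^^ (n - i)) v = 0" if "n \<ge> s + t" "i \<le> n" "i \<noteq> s \<or> n \<noteq> s + t" for i n
  proof (cases "s < i")
    case False
    then have "t < n - i" using that by auto
    then show ?thesis by (simp add: top_coeff_vanish[OF v])
  qed (simp add: top_coeff_vanish[OF u])
  have "(D ^^ (s + t)) (u * v) = (\<Sum>i\<in>{s}. of_nat (s + t choose i) * (D ^^ i) u * (D ^^ (s + t - i)) v)"
    unfolding leibniz by (rule sum.mono_neutral_right) (auto simp: zero mult.assoc)
  also have "\<dots> = of_nat (fact s * fact t * (s + t choose s)) * (c * c')"
    using u v by (simp add: top_coeff_def algebra_simps)
  also have "fact s * fact t * (s + t choose s) = fact (s + t)"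
    using binomial_fact_lemma[of s "s + t"] by simp
  finally have "(D ^^ (s + t)) (u * v) = of_nat (fact (s + t)) * (c * c')" .
  moreover have "(D ^^ Suc (s + t)) (u * v) = 0"
    unfolding leibniz by (rule sum.neutral) (auto simp: zero mult.assoc simp del: funpow.simps)
  ultimately show ?thesis
    unfolding top_coeff_def ..
qed

lemma top_coeff_const: "D c = 0 \<Longrightarrow> top_coeff 0 c c"
  by (simp add: top_coeff_def)

lemma top_coeff_power:
  assumes "top_coeff s u c"
  shows "top_coeff (s * n) (u ^ n) (c ^ n)"
proof (induction n)
  case (Suc n)
  show ?case
    using top_coeff_mult[OF assms Suc] by simp
qed (simp add: top_coeff_const)

lemma top_coeff_add_lower:
  assumes "top_coeff s u c" "(D ^^ s) v = 0"
  shows "top_coeff s (u + v) c"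
proof -
  have "(D ^^ Suc s) v = 0"
    using assms(2) by simp
  with assms show ?thesis
    unfolding top_coeff_def iter_add by (simp only: add_0_right)
qed

lemma D_power: "D (u ^ n) = of_nat n * u ^ (n - 1) * D u"
proof (induction n)
  case (Suc n)
  then show ?case by (cases n) (simp_all add: D_mult algebra_simps)
qed simp

lemma D_inverse:
  assumes "u * v = 1"
  shows "D v = - (v ^ 2 * D u)"
proof -
  have "D u * v + u * D v = 0"
    using D_mult[of u v] assms by simp
  then have "v * (D u * v + u * D v) = 0" by simp
  moreover have "v * (u * D v) = D v"
    using assms by (metis mult.assoc mult.commute mult_1)
  ultimately show ?thesis
    by (simp add: algebra_simps power2_eq_square eq_neg_iff_add_eq_0)
qed

end

lemma ratfun_const_eq_0_iff [simp]: "ratfun_const c = 0 \<longleftrightarrow> c = 0"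
  by (simp add: ratfun_const_def)

lemma ratfun_of_nat_eq_0_iff: "(of_nat n :: 'a::field_char_0 poly poly fract) = 0 \<longleftrightarrow> n = 0"
  using ratfun_const_eq_0_iff[of "of_nat n :: 'a"] by simp

text \<open>
  Both \<open>(x, y)\<close> and \<open>(y, x)\<close> are instances, which allows the smaller exponent of \<open>f\<close> to be attached to the
  first coordinate. The last assumption identifies the polynomial ring inside the field.
\<close>

locale coordinates = DX: derivation dX + DY: derivation dY
  for dX dY :: "'a::field_char_0 poly poly fract \<Rightarrow> 'a poly poly fract" +
  fixes X Y :: "'a poly poly fract"
  assumes coord: "dX X = 1" "dX Y = 0" "dY X = 0" "dY Y = 1"
    and const: "dX (ratfun_const c) = 0" "dY (ratfun_const c) = 0"
    and polynomials: "range to_fract = ratfun.K.span {X ^ i * Y ^ j | i j. True}"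
begin

text \<open>
  Distinct leading monomials \<open>X ^ p * Y ^ t\<close>, ordered first by \<open>t\<close> and then by \<open>p\<close>, force independence: the
  operator \<open>dX ^ P * dY ^ T\<close> belonging to the largest leading monomial with nonzero coefficient kills every
  other term and maps its own term to a nonzero constant, because the characteristic is zero.
\<close>

lemma top_coeffs_independent:
  fixes v :: "'i \<Rightarrow> 'a poly poly fract"
  assumes S: "finite S" and inj: "inj_on (\<lambda>\<alpha>. (p \<alpha>, t \<alpha>)) S"
    and top: "\<And>\<alpha>. \<alpha> \<in> S \<Longrightarrow> DY.top_coeff (t \<alpha>) (v \<alpha>) (X ^ p \<alpha>)"
    and zero: "(\<Sum>\<alpha>\<in>S. ratfun_const (c \<alpha>) * v \<alpha>) = 0"
  shows "\<forall>\<alpha>\<in>S. c \<alpha> = 0"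
proof (rule ccontr)
  define A where "A = {\<alpha>\<in>S. c \<alpha> \<noteq> 0}"
  assume "\<not> (\<forall>\<alpha>\<in>S. c \<alpha> = 0)"
  then have A: "finite A" "A \<noteq> {}"
    using S by (auto simp: A_def)
  define T where "T = Max (t ` A)"
  define A' where "A' = {\<alpha>\<in>A. t \<alpha> = T}"
  have "T \<in> t ` A"
    unfolding T_def using A by (intro Max_in) auto
  then have A': "finite A'" "A' \<noteq> {}"
    using A by (auto simp: A'_def)
  define P where "P = Max (p ` A')"
  have "P \<in> p ` A'"
    unfolding P_def using A' by (intro Max_in) auto
  then obtain \<beta> where \<beta>: "\<beta> \<in> A'" "p \<beta> = P" by blast
  then have \<beta>': "\<beta> \<in> S" "t \<beta> = T" "c \<beta> \<noteq> 0"
    by (auto simp: A'_def A_def)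
  let ?L = "\<lambda>u. (dX ^^ P) ((dY ^^ T) u)"
  have other: "?L (ratfun_const (c \<alpha>) * v \<alpha>) = 0" if \<alpha>: "\<alpha> \<in> S - {\<beta>}" for \<alpha>
  proof (cases "\<alpha> \<in> A")
    case True
    then have "t \<alpha> \<le> T"
      unfolding T_def using A by simp
    show ?thesis
    proof (cases "t \<alpha> = T")
      case eq: True
      then have "\<alpha> \<in> A'" using True by (simp add: A'_def)
      then have "p \<alpha> \<le> P"
        unfolding P_def using A' by simp
      moreover have "p \<alpha> \<noteq> P"
        using inj_onD[OF inj, of \<alpha> \<beta>] \<alpha> \<beta> \<beta>' eq by auto
      ultimately have "p \<alpha> choose P = 0"
        by (intro binomial_eq_0) simp
      then have "(dX ^^ P) (X ^ p \<alpha>) = 0"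
        unfolding DX.iter_power[OF coord(1)] by (simp only: mult_0_right of_nat_0 mult_zero_left)
      moreover have "dX (of_nat (fact T)) = 0"
        using const(1)[of "of_nat (fact T)"] by simp
      ultimately show ?thesis
        using top[of \<alpha>] \<alpha> eq
        by (simp add: DX.iter_mult_const DY.iter_mult_const const DY.top_coeff_def)
    next
      case False
      then have "(dY ^^ T) (v \<alpha>) = 0"
        using top[of \<alpha>] \<alpha> \<open>t \<alpha> \<le> T\<close> by (intro DY.top_coeff_vanish) auto
      then show ?thesis
        by (simp add: DY.iter_mult_const const)
    qed
  qed (use \<alpha> in \<open>auto simp: A_def\<close>)
  have "?L (\<Sum>\<alpha>\<in>S. ratfun_const (c \<alpha>) * v \<alpha>) = (\<Sum>\<alpha>\<in>S. ?L (ratfun_const (c \<alpha>) * v \<alpha>))"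
    by (simp add: DX.iter_sum DY.iter_sum)
  also have "\<dots> = ?L (ratfun_const (c \<beta>) * v \<beta>)"
    using other S \<beta>'(1) by (simp add: sum.remove[of S \<beta>])
  also have "\<dots> = ratfun_const (c \<beta>) * (of_nat (fact T) * (of_nat (fact P) * 1))"
  proof -
    have "dX (of_nat (fact T)) = 0"
      using const(1)[of "of_nat (fact T)"] by simp
    moreover have "(dX ^^ P) (X ^ P) = of_nat (fact P) * 1"
      by (simp add: DX.iter_power coord)
    ultimately show ?thesis
      using top[OF \<beta>'(1)] \<beta> \<beta>'
      by (simp add: DX.iter_mult_const DY.iter_mult_const const DY.top_coeff_def)
  qed
  finally have "ratfun_const (c \<beta>) * (of_nat (fact T) * (of_nat (fact P) * 1)) = 0"
    using zero by simp
  then show False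
    using \<beta>' by (simp add: ratfun_of_nat_eq_0_iff del: of_nat_fact)
qed

end

lemma (in vector_space) independent_image_of_family:
  fixes v :: "'c \<Rightarrow> 'b"
  assumes "finite S"
    and zero: "\<And>c. (\<Sum>\<alpha>\<in>S. scale (c \<alpha>) (v \<alpha>)) = 0 \<Longrightarrow> \<forall>\<alpha>\<in>S. c \<alpha> = 0"
  shows "inj_on v S" "independent (v ` S)"
proof -
  show inj: "inj_on v S"
  proof (rule inj_onI, rule ccontr)
    fix \<alpha> \<beta> assume ab: "\<alpha> \<in> S" "\<beta> \<in> S" "v \<alpha> = v \<beta>" "\<alpha> \<noteq> \<beta>"
    define c :: "'c \<Rightarrow> 'a" where "c \<gamma> = (if \<gamma> = \<alpha> then 1 else if \<gamma> = \<beta> then - 1 else 0)" for \<gamma>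
    have "(\<Sum>\<gamma>\<in>S. scale (c \<gamma>) (v \<gamma>)) = (\<Sum>\<gamma>\<in>{\<alpha>, \<beta>}. scale (c \<gamma>) (v \<gamma>))"
      using assms(1) ab by (intro sum.mono_neutral_right) (auto simp: c_def)
    also have "\<dots> = 0"
      using ab by (simp add: c_def)
    finally have "c \<alpha> = 0"
      using zero ab by blast
    then show False by (simp add: c_def)
  qed
  show "independent (v ` S)"
  proof (rule independent_if_scalars_zero)
    fix c b assume "(\<Sum>b\<in>v ` S. scale (c b) b) = 0" "b \<in> v ` S"
    then show "c b = 0"
      using zero[of "c \<circ> v"] by (auto simp: sum.reindex[OF inj])
  qed (use assms(1) in simp)
qed

section \<open>The filtration attached to the curve\<close>

locale curve = coordinates +
  fixes l m :: nat
  assumes m_pos: "0 < m" and m_le_l: "m \<le> l"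
begin

definition f :: "'a poly poly fract" where
  "f = X ^ m + Y ^ l + 1"

definition g :: "'a poly poly fract" where
  "g = inverse f"

definition e :: "nat \<times> nat \<times> nat \<Rightarrow> 'a poly poly fract" where
  "e = (\<lambda>(i, j, r). X ^ i * Y ^ j * g ^ r)"

lemma top_coeff_X: "DY.top_coeff 0 X X"
  by (simp add: DY.top_coeff_const coord)

lemma top_coeff_Y: "DY.top_coeff 1 Y 1"
  by (simp add: DY.top_coeff_def coord)

lemma top_coeff_f: "DY.top_coeff l f 1"
proof -
  have "DY.top_coeff l (Y ^ l) 1"
    using DY.top_coeff_power[OF top_coeff_Y, of l] by simp
  moreover have "dY (X ^ m + 1) = 0"
    by (simp add: DY.D_add DY.D_power_const coord)
  then have "DY.top_coeff 0 (X ^ m + 1) (X ^ m + 1)"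
    by (rule DY.top_coeff_const)
  then have "(dY ^^ l) (X ^ m + 1) = 0"
    by (rule DY.top_coeff_vanish) (use m_pos m_le_l in simp)
  ultimately have "DY.top_coeff l (Y ^ l + (X ^ m + 1)) 1"
    by (rule DY.top_coeff_add_lower)
  then show ?thesis
    by (simp add: f_def add_ac)
qed

lemma f_nonzero: "f \<noteq> 0"
  using top_coeff_f by (auto simp: DY.top_coeff_def ratfun_of_nat_eq_0_iff simp del: of_nat_fact)

lemma f_times_g: "f * g = 1"
  by (simp add: g_def f_nonzero)

text \<open>
  The relation \<open>f * g = 1\<close> in the form that lowers a power \<open>Y ^ (j + l)\<close> in the presence of a pole. Since the
  weight \<open>l * m\<close> of \<open>Y ^ l\<close> is also that of \<open>X ^ m\<close>, this reduction does not raise weights.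
\<close>

lemma e_reduce: "e (i, j + l, Suc r) = e (i, j, r) - e (i + m, j, Suc r) - e (i, j, Suc r)"
proof -
  have "X ^ i * Y ^ j * g ^ r = X ^ i * Y ^ j * g ^ r * (f * g)"
    by (simp add: f_times_g)
  then show ?thesis
    by (simp add: e_def f_def algebra_simps power_add)
qed

lemma X_e: "X * e (i, j, r) = e (Suc i, j, r)"
  by (simp add: e_def)

lemma Y_e: "Y * e (i, j, r) = e (i, Suc j, r)"
  by (simp add: e_def)

lemma dX_g: "dX g = - (g ^ 2 * (of_nat m * X ^ (m - 1)))"
  by (simp add: DX.D_inverse[OF f_times_g] f_def DX.D_add DX.D_power coord)

lemma dY_g: "dY g = - (g ^ 2 * (of_nat l * Y ^ (l - 1)))"
  by (simp add: DY.D_inverse[OF f_times_g] f_def DY.D_add DY.D_power coord)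

lemma dX_e:
  "dX (e (i, j, r)) = of_nat i * e (i - 1, j, r) - of_nat (r * m) * e (i + (m - 1), j, Suc r)"
proof -
  have g: "of_nat r * g ^ (r - 1) * g ^ 2 = of_nat r * g ^ Suc r"
    by (cases r) (simp_all add: power2_eq_square)
  have "dX (e (i, j, r)) = of_nat i * (X ^ (i - 1) * Y ^ j * g ^ r)
      - X ^ i * Y ^ j * (of_nat r * g ^ (r - 1) * g ^ 2) * (of_nat m * X ^ (m - 1))"
    by (simp add: e_def DX.D_mult DX.D_power coord dX_g algebra_simps)
  then show ?thesis
    unfolding g by (simp add: e_def power_add algebra_simps)
qed

lemma dY_e:
  "dY (e (i, j, r)) = of_nat j * e (i, j - 1, r) - of_nat (r * l) * e (i, j + (l - 1), Suc r)"
proof -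
  have g: "of_nat r * g ^ (r - 1) * g ^ 2 = of_nat r * g ^ Suc r"
    by (cases r) (simp_all add: power2_eq_square)
  have "dY (e (i, j, r)) = of_nat j * (X ^ i * Y ^ (j - 1) * g ^ r)
      - X ^ i * Y ^ j * (of_nat r * g ^ (r - 1) * g ^ 2) * (of_nat l * Y ^ (l - 1))"
    by (simp add: e_def DY.D_mult DY.D_power coord dY_g algebra_simps)
  then show ?thesis
    unfolding g by (simp add: e_def power_add algebra_simps)
qed

text \<open>
  The exponents \<open>(i, j, r)\<close> of the elements \<open>X ^ i * Y ^ j * g ^ r\<close> spanning the \<open>k\<close>-th filtration step. For
  \<open>r = n + 1\<close> the last condition is \<open>l * i + m * j \<le> l * (k - n) + m * (l - 1) * n\<close>, rearranged so that
  no difference of natural numbers occurs.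
\<close>

definition idx :: "nat \<Rightarrow> (nat \<times> nat \<times> nat) set" where
  "idx k = {(i, j, r). case r of 0 \<Rightarrow> i + j \<le> k
     | Suc n \<Rightarrow> j < l \<and> n \<le> k \<and> l * i + m * j + (l + m) * n \<le> l * k + l * m * n}"

lemma idx_0: "(i, j, 0) \<in> idx k \<longleftrightarrow> i + j \<le> k"
  and idx_Suc: "(i, j, Suc n) \<in> idx k \<longleftrightarrow>
    j < l \<and> n \<le> k \<and> l * i + m * j + (l + m) * n \<le> l * k + l * m * n"
  by (simp_all add: idx_def)

definition G :: "nat \<Rightarrow> 'a poly poly fract set" where
  "G k = ratfun.K.span (e ` idx k)"

lemma e_in_G: "\<alpha> \<in> idx k \<Longrightarrow> e \<alpha> \<in> G k"
  unfolding G_def by (intro ratfun.K.span_base imageI)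

lemma G_subspace: "ratfun.K.subspace (G k)"
  unfolding G_def by simp

lemma subspace_of_nat_mult: "ratfun.K.subspace S \<Longrightarrow> u \<in> S \<Longrightarrow> of_nat n * u \<in> S"
  using ratfun.K.subspace_scale[of S u "of_nat n"] by simp

lemma subspace_of_nat_mult_iff:
  fixes S :: "'a poly poly fract set"
  assumes "ratfun.K.subspace S" "n > 0"
  shows "of_nat n * u \<in> S \<longleftrightarrow> u \<in> S"
proof
  assume "of_nat n * u \<in> S"
  then have "ratfun_const (inverse (of_nat n)) * (of_nat n * u) \<in> S"
    using ratfun.K.subspace_scale[OF assms(1)] by simp
  moreover have "ratfun_const (inverse (of_nat n)) * of_nat n = (1 :: 'a poly poly fract)"
    using assms(2) by (simp flip: ratfun_const_of_nat ratfun_const_simps)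
  ultimately show "u \<in> S"
    by (simp only: mult_1 flip: mult.assoc)
qed (rule subspace_of_nat_mult[OF assms(1)])

lemma span_image_mono:
  assumes add: "\<And>u v. T (u + v) = T u + T v"
    and scale: "\<And>c u. T (ratfun_const c * u) = ratfun_const c * T u"
    and S: "ratfun.K.subspace S" and T: "\<And>v. v \<in> V \<Longrightarrow> T v \<in> S"
    and u: "u \<in> ratfun.K.span V"
  shows "T u \<in> S"
proof -
  have "T 0 = 0"
    using scale[of 0 0] by simp
  then have "ratfun.K.subspace {v. T v \<in> S}"
    using S unfolding ratfun.K.subspace_def by (simp add: add scale)
  then show ?thesis
    using ratfun.K.span_minimal[of V "{v. T v \<in> S}"] T u by blast
qed

text \<open>
  No operator raises the weight by more than the growth of the bound in \<open>idx\<close>. Only \<open>Y\<close> times an element with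
  \<open>j = l - 1\<close>, and \<open>dY\<close> of an element with \<open>j > 0\<close>, leave the range \<open>j < l\<close>; \<open>e_reduce\<close> brings them back. The
  assumption \<open>m \<le> l\<close> is used here: multiplication by \<open>Y\<close> may raise the weight only by \<open>l\<close>, and \<open>dX f\<close>, of
  weight \<open>l * (m - 1)\<close>, must not be heavier than \<open>dY f\<close>, of weight \<open>m * (l - 1)\<close>.
\<close>

lemma G_stable:
  assumes u: "u \<in> G k"
  shows "u \<in> G (Suc k)" "X * u \<in> G (Suc k)" "Y * u \<in> G (Suc k)"
    "dX u \<in> G (Suc k)" "dY u \<in> G (Suc k)"
proof -
  note closure = ratfun.K.subspace_diff[OF G_subspace] subspace_of_nat_mult[OF G_subspace] e_in_G
  have incl: "e (i, j, r) \<in> G (Suc k)" if "(i, j, r) \<in> idx k" for i j r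
    using that by (intro e_in_G) (cases r; simp add: idx_0 idx_Suc)
  have X: "X * e (i, j, r) \<in> G (Suc k)" if "(i, j, r) \<in> idx k" for i j r
    unfolding X_e using that by (intro e_in_G) (cases r; simp add: idx_0 idx_Suc algebra_simps)
  have Y: "Y * e (i, j, r) \<in> G (Suc k)" if \<alpha>: "(i, j, r) \<in> idx k" for i j r
  proof (cases r)
    case 0
    then show ?thesis
      unfolding Y_e using \<alpha> by (intro e_in_G) (simp add: idx_0)
  next
    case (Suc n)
    have le: "l * i + m * j + (l + m) * n \<le> l * k + l * m * n" "j < l" "n \<le> k"
      using \<alpha> Suc by (simp_all add: idx_Suc)
    show ?thesis
    proof (cases "Suc j = l")
      case False
      then show ?thesis
        unfolding Y_e Suc using le m_le_l by (intro e_in_G) (simp add: idx_Suc algebra_simps)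
    next
      case True
      have ml: "m * j + m = l * m"
        using True by (metis mult.commute mult_Suc_right add.commute)
      have "(i, 0, n) \<in> idx (Suc k)"
      proof (cases n)
        case 0
        then have "l * i + m * j \<le> l * k" using le by simp
        then have "l * i \<le> l * k" by linarith
        then have "i \<le> k" using m_pos m_le_l by simp
        then show ?thesis by (simp add: 0 idx_0)
      next
        case (Suc n')
        then show ?thesis
          using le ml m_pos m_le_l by (simp add: idx_Suc algebra_simps)
      qed
      moreover have "(i + m, 0, Suc n) \<in> idx (Suc k)" "(i, 0, Suc n) \<in> idx (Suc k)"
        using le ml m_pos m_le_l by (simp_all add: idx_Suc algebra_simps)
      ultimately show ?thesis
        using e_reduce[of i 0 n] True unfolding Y_e Suc by (simp add: closure)
    qed
  qed
  have dX: "dX (e (i, j, r)) \<in> G (Suc k)" if \<alpha>: "(i, j, r) \<in> idx k" for i j r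
  proof -
    have "of_nat i * e (i - 1, j, r) \<in> G (Suc k)"
    proof (intro closure)
      show "(i - 1, j, r) \<in> idx (Suc k)"
        using \<alpha> by (cases i; cases r; simp add: idx_0 idx_Suc)
    qed
    moreover have "of_nat (r * m) * e (i + (m - 1), j, Suc r) \<in> G (Suc k)"
    proof (cases r)
      case (Suc n)
      have "l * (m - 1) + l = l * m"
        using m_pos by (cases m) simp_all
      then show ?thesis
        using \<alpha> m_le_l unfolding Suc
        by (intro closure) (simp add: idx_Suc algebra_simps)
    qed (simp add: ratfun.K.subspace_0[OF G_subspace])
    ultimately show ?thesis
      unfolding dX_e by (rule closure)
  qed
  have dY: "dY (e (i, j, r)) \<in> G (Suc k)" if \<alpha>: "(i, j, r) \<in> idx k" for i j r
  proof -
    have "of_nat j * e (i, j - 1, r) \<in> G (Suc k)"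
    proof (intro closure)
      show "(i, j - 1, r) \<in> idx (Suc k)"
        using \<alpha> by (cases j; cases r; simp add: idx_0 idx_Suc)
    qed
    moreover have "of_nat (r * l) * e (i, j + (l - 1), Suc r) \<in> G (Suc k)"
    proof (cases r)
      case (Suc n)
      have le: "l * i + m * j + (l + m) * n \<le> l * k + l * m * n" "j < l" "n \<le> k"
        using \<alpha> Suc by (simp_all add: idx_Suc)
      obtain l' where l: "l = Suc l'"
        using le(2) by (cases l) simp_all
      have "e (i, j + (l - 1), Suc (Suc n)) \<in> G (Suc k)"
      proof (cases j)
        case 0
        have "(i, l - 1, Suc (Suc n)) \<in> idx (Suc k)"
          using le unfolding idx_Suc by (simp add: l 0 algebra_simps)
        then show ?thesis
          by (simp add: 0 e_in_G)
      next
        case (Suc j')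
        have "(i, j', Suc n) \<in> idx (Suc k)" "(i + m, j', Suc (Suc n)) \<in> idx (Suc k)"
          "(i, j', Suc (Suc n)) \<in> idx (Suc k)"
          using le m_pos m_le_l by (simp_all add: idx_Suc Suc algebra_simps)
        moreover have "j + (l - 1) = j' + l"
          using Suc le by simp
        ultimately show ?thesis
          by (simp add: e_reduce closure)
      qed
      then show ?thesis
        unfolding Suc by (rule closure)
    qed (simp add: ratfun.K.subspace_0[OF G_subspace])
    ultimately show ?thesis
      unfolding dY_e by (rule closure)
  qed
  have extend: "T u \<in> G (Suc k)"
    if "\<And>u v. T (u + v) = T u + T v" "\<And>c u. T (ratfun_const c * u) = ratfun_const c * T u"
      and T: "\<And>i j r. (i, j, r) \<in> idx k \<Longrightarrow> T (e (i, j, r)) \<in> G (Suc k)" for T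
  proof (rule span_image_mono[OF that(1,2) G_subspace _ u[unfolded G_def]])
    fix v assume "v \<in> e ` idx k"
    then obtain i j r where "(i, j, r) \<in> idx k" "v = e (i, j, r)"
      by (metis imageE prod_cases3)
    then show "T v \<in> G (Suc k)"
      using T by blast
  qed
  show "u \<in> G (Suc k)"
    by (rule extend[of "\<lambda>u. u"]) (simp_all add: incl)
  show "X * u \<in> G (Suc k)"
    by (rule extend[of "\<lambda>u. X * u"]) (simp_all add: X distrib_left mult.left_commute)
  show "Y * u \<in> G (Suc k)"
    by (rule extend[of "\<lambda>u. Y * u"]) (simp_all add: Y distrib_left mult.left_commute)
  show "dX u \<in> G (Suc k)"
    by (rule extend[of dX]) (simp_all add: dX DX.D_add DX.D_mult const)
  show "dY u \<in> G (Suc k)"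
    by (rule extend[of dY]) (simp_all add: dY DY.D_add DY.D_mult const)
qed

text \<open>
  In the rows \<open>n \<le> k\<close> the elements without a factor \<open>X\<close> are old, so that multiplication by \<open>X\<close> generates the
  new ones.
\<close>

lemma idx_without_X:
  assumes j: "j < l" and n: "n \<le> k" and k: "m \<le> k"
  shows "(0, j, Suc n) \<in> idx k"
proof -
  have "m * j + (l + m) * n \<le> l * k + l * m * n"
  proof (cases n)
    case 0
    have "m * j \<le> k * l"
      using j k by (intro mult_le_mono) simp_all
    then show ?thesis by (simp add: 0 mult.commute)
  next
    case (Suc n')
    have "n' \<le> l * n'"
      using j by (cases l) simp_all
    moreover have "l * n = l + l * n'"
      by (simp add: Suc)
    ultimately have "j + n \<le> l * n"
      using j Suc by linarith
    then have "m * (j + n) \<le> m * (l * n)"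
      by (rule mult_le_mono2)
    moreover have "l * n \<le> l * k"
      using n by (rule mult_le_mono2)
    moreover have "m * (j + n) = m * j + m * n" "m * (l * n) = l * m * n" "(l + m) * n = l * n + m * n"
      by (simp_all add: distrib_left distrib_right)
    ultimately show ?thesis
      by linarith
  qed
  then show ?thesis
    using j n by (simp add: idx_Suc)
qed

text \<open>
  Polynomials and pole orders at most \<open>k + 1\<close> are reached by multiplications. In pole order \<open>k + 2\<close>, the
  highest term of \<open>dX\<close> and \<open>dY\<close> provides the elements of the last row of \<open>G k\<close> multiplied by \<open>X ^ (m - 1)\<close> or
  \<open>Y ^ (l - 1)\<close>. The remaining elements are written as combinations of these by means of \<open>e_reduce\<close>, read
  as a formula for its last term if \<open>i < m\<close>, and as a formula for \<open>X ^ m\<close> times that term if \<open>i \<ge> m\<close>.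
\<close>

lemma G_generated:
  assumes k: "m + 2 \<le> k" and S: "ratfun.K.subspace S"
    and sub: "\<And>u. u \<in> G k \<Longrightarrow> u \<in> S \<and> X * u \<in> S \<and> Y * u \<in> S \<and> dX u \<in> S \<and> dY u \<in> S"
  shows "G (Suc k) \<subseteq> S"
proof -
  note diff = ratfun.K.subspace_diff[OF S]
  have sub': "e (i, j, r) \<in> S" "e (Suc i, j, r) \<in> S" "e (i, Suc j, r) \<in> S"
    "dX (e (i, j, r)) \<in> S" "dY (e (i, j, r)) \<in> S" if "(i, j, r) \<in> idx k" for i j r
    using sub[OF e_in_G[OF that]] by (simp_all add: X_e Y_e)
  have polys: "e (i, j, 0) \<in> S" if "i + j \<le> Suc k" for i j
  proof (cases "i + j \<le> k")
    case False
    then show ?thesis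
      using that sub'(2)[of "i - 1" j 0] sub'(3)[of i "j - 1" 0]
      by (cases i; cases j) (auto simp: idx_0)
  qed (simp add: sub' idx_0)
  have low: "e (i, j, Suc n) \<in> S" if \<alpha>: "(i, j, Suc n) \<in> idx (Suc k)" and n: "n \<le> k" for i j n
  proof (cases i)
    case 0
    then show ?thesis
      using idx_without_X[of j n k] \<alpha> n k by (simp add: sub' idx_Suc)
  next
    case (Suc i')
    then have "(i', j, Suc n) \<in> idx k"
      using \<alpha> n by (simp add: idx_Suc)
    then show ?thesis
      unfolding Suc by (rule sub')
  qed
  have from_dX: "e (i + (m - 1), j, Suc (Suc k)) \<in> S"
    if "(i, j, Suc k) \<in> idx k" for i j
  proof -
    have "(i - 1, j, Suc k) \<in> idx k"
      using that by (cases i) (simp_all add: idx_Suc)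
    then have "of_nat i * e (i - 1, j, Suc k) - dX (e (i, j, Suc k)) \<in> S"
      by (intro diff subspace_of_nat_mult[OF S] sub' that)
    then show ?thesis
      unfolding dX_e using m_pos by (simp add: subspace_of_nat_mult_iff[OF S] del: of_nat_mult mult_Suc)
  qed
  have from_dY: "e (i, j + (l - 1), Suc (Suc k)) \<in> S"
    if "(i, j, Suc k) \<in> idx k" for i j
  proof -
    have "(i, j - 1, Suc k) \<in> idx k"
      using that by (cases j) (simp_all add: idx_Suc)
    then have "of_nat j * e (i, j - 1, Suc k) - dY (e (i, j, Suc k)) \<in> S"
      by (intro diff subspace_of_nat_mult[OF S] sub' that)
    then show ?thesis
      unfolding dY_e using m_pos m_le_l
      by (simp add: subspace_of_nat_mult_iff[OF S] del: of_nat_mult mult_Suc)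
  qed
  \<comment> \<open>The weight bound of the new row \<open>n = k + 1\<close> of \<open>idx (k + 1)\<close>, with \<open>l * (k + 1)\<close> cancelled.\<close>
  have top: "e (i, j, Suc (Suc k)) \<in> S"
    if "j < l" "l * i + m * j + m * k + m \<le> l * m * k + l * m" for i j
    using that
  proof (induction i rule: less_induct)
    case (less i)
    show ?case
    proof (cases "Suc j = l")
      case True
      have "m * j + m = l * m"
        using True by (metis mult.commute mult_Suc_right add.commute)
      then have "(i, 0, Suc k) \<in> idx k"
        using less.prems by (simp add: idx_Suc algebra_simps)
      then have "e (i, 0 + (l - 1), Suc (Suc k)) \<in> S"
        by (rule from_dY)
      moreover have "0 + (l - 1) = j"
        using True by simp
      ultimately show ?thesis by simp
    next
      case False
      then have j: "Suc j < l" using less.prems by simp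
      show ?thesis
      proof (cases "m \<le> i")
        case True
        \<comment> \<open>Replace \<open>X ^ m\<close> by \<open>f - Y ^ l - 1\<close>; the last of the three terms has smaller exponent \<open>i'\<close>.\<close>
        define i' where "i' = i - m"
        have i: "i = i' + m" using True by (simp add: i'_def)
        have le: "l * i' + m * j + m * k + m \<le> l * m * k"
          using less.prems by (simp add: i algebra_simps)
        have "e (i', j, Suc k) \<in> S"
          by (rule low) (use le j in \<open>simp_all add: idx_Suc algebra_simps\<close>)
        moreover have "(i', Suc j, Suc k) \<in> idx k"
          using le j by (simp add: idx_Suc algebra_simps)
        from from_dY[OF this] have "e (i', j + l, Suc (Suc k)) \<in> S"
          using j by simp
        moreover have "e (i', j, Suc (Suc k)) \<in> S"
          by (rule less.IH) (use le j m_pos in \<open>simp_all add: i\<close>)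
        moreover have "e (i, j, Suc (Suc k))
            = e (i', j, Suc k) - e (i', j + l, Suc (Suc k)) - e (i', j, Suc (Suc k))"
          by (simp add: i e_reduce)
        ultimately show ?thesis
          by (simp add: diff)
      next
        case False
        \<comment> \<open>Here the weight is bounded, and \<open>1 = f - X ^ m - Y ^ l\<close> can be inserted, as the last row of
          \<open>G k\<close> has enough room for the increased weight as soon as \<open>k \<ge> 2\<close>.\<close>
        have i_le: "l * i + l \<le> l * m"
          using False mult_le_mono2[of "Suc i" m l] by simp
        have j_le: "m * j + 2 * m \<le> l * m"
          using j mult_le_mono2[of "j + 2" l m] by (simp add: algebra_simps)
        have "2 * (m * (l - 1)) \<le> k * (m * (l - 1))"
          using k by (intro mult_le_mono1) simp
        moreover have "m * (l - 1) + m = l * m"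
          using j by (cases l) simp_all
        then have "k * (m * (l - 1)) + m * k = l * m * k" "2 * (m * (l - 1)) + 2 * m = 2 * (l * m)"
          by (metis distrib_left mult.commute)+
        ultimately have A: "2 * (l * m) + m * k \<le> l * m * k + 2 * m"
          by linarith
        have "e (i, j, Suc k) \<in> S"
          by (rule low) (use i_le j_le A j in \<open>simp_all add: idx_Suc algebra_simps\<close>)
        moreover have "(Suc i, j, Suc k) \<in> idx k"
          using i_le j_le A j by (simp add: idx_Suc algebra_simps)
        from from_dX[OF this] have "e (i + m, j, Suc (Suc k)) \<in> S"
          using m_pos by simp
        moreover have "(i, Suc j, Suc k) \<in> idx k"
          using i_le j_le A j m_le_l by (simp add: idx_Suc algebra_simps)
        from from_dY[OF this] have "e (i, j + l, Suc (Suc k)) \<in> S"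
          using j by simp
        moreover have "e (i, j, Suc (Suc k))
            = e (i, j, Suc k) - e (i, j + l, Suc (Suc k)) - e (i + m, j, Suc (Suc k))"
          by (simp add: e_reduce)
        ultimately show ?thesis
          by (simp add: diff)
      qed
    qed
  qed
  have "e (i, j, r) \<in> S" if \<alpha>: "(i, j, r) \<in> idx (Suc k)" for i j r
  proof (cases r)
    case 0
    then show ?thesis using \<alpha> polys by (simp add: idx_0)
  next
    case (Suc n)
    then consider "n \<le> k" | "n = Suc k"
      using \<alpha> by (auto simp: idx_Suc le_Suc_eq)
    then show ?thesis
    proof cases
      case 1
      then show ?thesis using low \<alpha> Suc by simp
    next
      case 2
      then show ?thesis
        using top[of j i] \<alpha> by (simp add: Suc idx_Suc algebra_simps)
    qed
  qed
  then show ?thesis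
    unfolding G_def by (intro ratfun.K.span_minimal S) auto
qed

end

section \<open>Hilbert polynomial\<close>

lemma sum_arith_progression:
  fixes A B :: rat
  shows "(\<Sum>n\<le>k. A + B * of_nat n) = A * of_nat (k + 1) + B * of_nat (k * (k + 1)) / 2"
  by (induction k) (simp_all add: field_simps)

text \<open>
  Raising \<open>s\<close> by one drops the last of \<open>l\<close> consecutive terms and adds a new first one, which exceeds the dropped
  one by exactly \<open>m\<close>, the numerators being \<open>m * l\<close> apart. This is why the row sizes of the filtration are
  linear functions rather than merely quasi-linear.
\<close>

lemma floor_sum_shift:
  assumes "l > 0"
  shows "(\<Sum>j<l. (int m * (int s - int j)) div int l)
    = (\<Sum>j<l. (int m * (- int j)) div int l) + int m * int s"
proof (induction s)
  case (Suc s)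
  let ?a = "\<lambda>s j. (int m * (s - int j)) div int l"
  obtain l' where l: "l = Suc l'"
    using assms by (cases l) simp_all
  have "(\<Sum>j<l. ?a (int (Suc s)) j) = ?a (int (Suc s)) 0 + (\<Sum>j<l'. ?a (int s) j)"
    unfolding l sum.lessThan_Suc_shift by simp
  also have "?a (int (Suc s)) 0 = (int m * (int s - int l') + int m * int l) div int l"
    by (simp add: l algebra_simps)
  also have "\<dots> = ?a (int s) l' + int m"
    using assms by simp
  also have "?a (int s) l' + int m + (\<Sum>j<l'. ?a (int s) j) = (\<Sum>j<l. ?a (int s) j) + int m"
    unfolding l by simp
  finally show ?case
    using Suc by (simp add: algebra_simps)
qed simp

context curve
begin

lemma l_pos: "0 < l"
  using m_pos m_le_l by simp

lemma finite_idx: "finite (idx k)"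
proof (rule finite_subset)
  show "idx k \<subseteq> {..k + m * k} \<times> {..k + l} \<times> {..Suc k}"
  proof (intro subsetI)
    fix \<alpha> assume "\<alpha> \<in> idx k"
    moreover obtain i j r where \<alpha>_eq: "\<alpha> = (i, j, r)" by (metis prod_cases3)
    ultimately have \<alpha>: "(i, j, r) \<in> idx k" by simp
    have "i \<le> k + m * k \<and> j \<le> k + l \<and> r \<le> Suc k"
    proof (cases r)
      case 0
      then show ?thesis using \<alpha> by (auto simp: idx_0)
    next
      case (Suc n)
      have le: "l * i + m * j + (l + m) * n \<le> l * k + l * m * n" "j < l" "n \<le> k"
        using \<alpha> Suc by (simp_all add: idx_Suc)
      have "l * m * n \<le> l * (m * k)"
        using le(3) by (simp add: mult.assoc)
      then have "l * i \<le> l * (k + m * k)"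
        using le(1) unfolding distrib_left by linarith
      then show ?thesis
        using l_pos le Suc by simp
    qed
    then show "\<alpha> \<in> {..k + m * k} \<times> {..k + l} \<times> {..Suc k}"
      by (simp add: \<alpha>_eq)
  qed
qed auto

text \<open>
  After multiplication by \<open>f ^ (k + 1)\<close> the elements become polynomials with leading monomial
  \<open>X ^ i * Y ^ (j + l * (k + 1 - r))\<close>. These are distinct: for \<open>r > 0\<close>, division of the exponent of \<open>Y\<close> by \<open>l\<close>
  recovers \<open>j\<close> and \<open>r\<close>, and the exponent is below \<open>l * (k + 1)\<close>, as opposed to the case \<open>r = 0\<close>.
\<close>

lemma e_independent: "inj_on e (idx k)" "ratfun.K.independent (e ` idx k)"
proof -
  define t where "t = (\<lambda>(i :: nat, j, r). j + l * (Suc k - r))"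
  have r_le: "r \<le> Suc k" if "(i, j, r) \<in> idx k" for i j r
    using that by (cases r) (auto simp: idx_0 idx_Suc)
  have top: "DY.top_coeff (t \<alpha>) (f ^ Suc k * e \<alpha>) (X ^ fst \<alpha>)" if \<alpha>: "\<alpha> \<in> idx k" for \<alpha>
  proof -
    obtain i j r where \<alpha>_eq: "\<alpha> = (i, j, r)" by (metis prod_cases3)
    have "f ^ Suc k = f ^ (Suc k - r) * f ^ r"
      using r_le \<alpha> unfolding \<alpha>_eq by (metis le_add_diff_inverse2 power_add)
    then have "f ^ Suc k * e \<alpha> = X ^ i * (Y ^ j * f ^ (Suc k - r)) * (f * g) ^ r"
      by (simp only: \<alpha>_eq e_def prod.case power_mult_distrib) (simp only: mult_ac)
    moreover have "DY.top_coeff (0 * i + (1 * j + l * (Suc k - r)))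
        (X ^ i * (Y ^ j * f ^ (Suc k - r))) (X ^ i * (1 ^ j * 1 ^ (Suc k - r)))"
      by (intro DY.top_coeff_mult DY.top_coeff_power top_coeff_X top_coeff_Y top_coeff_f)
    ultimately show ?thesis
      by (simp add: \<alpha>_eq t_def f_times_g)
  qed
  have inj: "inj_on (\<lambda>\<alpha>. (fst \<alpha>, t \<alpha>)) (idx k)"
  proof (rule inj_onI)
    fix \<alpha> \<beta> assume ab: "\<alpha> \<in> idx k" "\<beta> \<in> idx k" "(fst \<alpha>, t \<alpha>) = (fst \<beta>, t \<beta>)"
    obtain i j r where \<alpha>_eq: "\<alpha> = (i, j, r)" by (metis prod_cases3)
    obtain j' r' where \<beta>_eq: "\<beta> = (i, j', r')"
      using ab(3) \<alpha>_eq by (metis fst_conv prod_cases3 prod.inject)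
    have less: "t (i, j, Suc n) < l * Suc k" if "(i, j, Suc n) \<in> idx k" for i j n
    proof -
      have "j < l" "n \<le> k" using that by (simp_all add: idx_Suc)
      then have "t (i, j, Suc n) < l * Suc (k - n)"
        by (simp add: t_def)
      also have "\<dots> \<le> l * Suc k" by simp
      finally show ?thesis .
    qed
    have ge: "l * Suc k \<le> t (i, j, 0)" for i j
      by (simp add: t_def)
    have eq: "t (i, j, r) = t (i, j', r')"
      using ab by (simp add: \<alpha>_eq \<beta>_eq)
    show "\<alpha> = \<beta>"
    proof (cases r; cases r')
      assume "r = 0" "r' = 0"
      then show ?thesis using eq by (simp add: \<alpha>_eq \<beta>_eq t_def)
    next
      fix n' assume "r = 0" "r' = Suc n'"
      then show ?thesis using eq less[of i j' n'] ge[of i j] ab by (simp add: \<beta>_eq)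
    next
      fix n assume "r = Suc n" "r' = 0"
      then show ?thesis using eq less[of i j n] ge[of i j'] ab by (simp add: \<alpha>_eq)
    next
      fix n n' assume r: "r = Suc n" "r' = Suc n'"
      have lt: "j < l" "j' < l" "n \<le> k" "n' \<le> k"
        using ab by (simp_all add: \<alpha>_eq \<beta>_eq r idx_Suc)
      have eq': "j + l * (k - n) = j' + l * (k - n')"
        using eq by (simp add: t_def r)
      then have "j = j'"
        using lt by (metis mod_less mod_mult_self2)
      with eq' lt show ?thesis
        using l_pos by (auto simp: \<alpha>_eq \<beta>_eq r)
    qed
  qed
  have zero: "\<forall>\<alpha>\<in>idx k. c \<alpha> = 0"
    if "(\<Sum>\<alpha>\<in>idx k. ratfun_act (weyl_const (c \<alpha>)) (e \<alpha>)) = 0" for c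
  proof (rule top_coeffs_independent[OF finite_idx inj top])
    have "0 = f ^ Suc k * (\<Sum>\<alpha>\<in>idx k. ratfun_act (weyl_const (c \<alpha>)) (e \<alpha>))"
      using that by simp
    then show "(\<Sum>\<alpha>\<in>idx k. ratfun_const (c \<alpha>) * (f ^ Suc k * e \<alpha>)) = 0"
      by (simp only: ratfun_act_weyl_const sum_distrib_left mult.left_commute)
  qed
  show "inj_on e (idx k)" "ratfun.K.independent (e ` idx k)"
    using ratfun.K.independent_image_of_family[OF finite_idx zero] by blast+
qed

lemma dim_G: "ratfun.K.dim (G k) = card (idx k)"
  unfolding G_def
  by (simp only: ratfun.K.dim_span_eq_card_independent[OF e_independent(2)]
      card_image[OF e_independent(1)])

text \<open>
  The multiple \<open>l * (k - n)\<close> splits off from the quotient that bounds \<open>i\<close>. What is left depends on \<open>j\<close> only through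
  \<open>(l - 1) * n - j\<close>, which is the shape summed over \<open>j < l\<close> in \<open>floor_sum_shift\<close>.
\<close>

lemma card_row:
  assumes "m \<le> k" "n \<le> k" "j < l"
  shows "int (card {i. l * i + m * j + (l + m) * n \<le> l * k + l * m * n})
    = int k - int n + 1 + (int m * (int ((l - 1) * n) - int j)) div int l"
proof -
  have "(0, j, Suc n) \<in> idx k"
    using assms by (intro idx_without_X)
  then have le: "m * j + (l + m) * n \<le> l * k + l * m * n"
    by (simp add: idx_Suc)
  define q where "q = (l * k + l * m * n - (m * j + (l + m) * n)) div l"
  have "l * i + m * j + (l + m) * n \<le> l * k + l * m * n \<longleftrightarrow> i \<le> q" for i
    using le l_pos by (simp add: q_def less_eq_div_iff_mult_less_eq le_diff_conv2 add_ac mult_ac)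
  then have "{i. l * i + m * j + (l + m) * n \<le> l * k + l * m * n} = {..q}"
    by auto
  then have "int (card {i. l * i + m * j + (l + m) * n \<le> l * k + l * m * n}) = int q + 1"
    by simp
  also have "int q = (int (l * k + l * m * n) - int (m * j + (l + m) * n)) div int l"
    using le by (simp add: q_def zdiv_int of_nat_diff)
  also have "int (l * k + l * m * n) - int (m * j + (l + m) * n)
      = int m * (int ((l - 1) * n) - int j) + (int k - int n) * int l"
    using l_pos by (simp add: of_nat_diff algebra_simps)
  also have "\<dots> div int l = int k - int n + (int m * (int ((l - 1) * n) - int j)) div int l"
    using l_pos by simp
  finally show ?thesis by simp
qed

text \<open>
  The nonpositive constant that rounding adds to the size of each row. It enters the Hilbert
  polynomial only below the leading term.
\<close>

definition defect :: int where
  "defect = (\<Sum>j<l. (int m * (- int j)) div int l)"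

lemma card_idx:
  assumes k: "m \<le> k"
  shows "int (card (idx k)) = (\<Sum>n\<le>k. int k + 1 - int n)
    + (\<Sum>n\<le>k. int l * (int k + 1 - int n) + defect + int m * int ((l - 1) * n))"
proof -
  define R where "R n j = {i. l * i + m * j + (l + m) * n \<le> l * k + l * m * n}" for n j
  define A where "A = (SIGMA i:{..k}. {..k - i})"
  define B where "B = (SIGMA n:{..k}. SIGMA j:{..<l}. R n j)"
  have fin: "finite (R n j)" if "n \<le> k" for n j
  proof (rule finite_subset)
    show "R n j \<subseteq> {..l * k + l * m * n}"
    proof
      fix i assume "i \<in> R n j"
      then have "l * i \<le> l * k + l * m * n" by (simp add: R_def)
      moreover have "i \<le> l * i" using l_pos by (cases l) simp_all
      ultimately show "i \<in> {..l * k + l * m * n}"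
        unfolding atMost_iff by (rule le_trans[rotated])
    qed
  qed simp
  have idx: "idx k = (\<lambda>(i, j). (i, j, 0)) ` A \<union> (\<lambda>(n, j, i). (i, j, Suc n)) ` B"
  proof (intro set_eqI iffI)
    fix \<alpha> assume \<alpha>: "\<alpha> \<in> idx k"
    obtain i j r where "\<alpha> = (i, j, r)" by (metis prod_cases3)
    with \<alpha> show "\<alpha> \<in> (\<lambda>(i, j). (i, j, 0)) ` A \<union> (\<lambda>(n, j, i). (i, j, Suc n)) ` B"
      by (cases r) (force simp: idx_0 idx_Suc A_def B_def R_def)+
  qed (auto simp: idx_0 idx_Suc A_def B_def R_def)
  have inj: "inj_on (\<lambda>(i, j). (i, j, 0 :: nat)) A" "inj_on (\<lambda>(n, j, i). (i, j, Suc n)) B"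
    by (auto simp: inj_on_def)
  have "finite A" "finite B"
    unfolding A_def B_def using fin by (auto intro!: finite_SigmaI)
  then have "card (idx k) = card A + card B"
    unfolding idx by (subst card_Un_disjoint) (auto simp: card_image[OF inj(1)] card_image[OF inj(2)])
  also have "card A = (\<Sum>n\<le>k. k - n + 1)"
    unfolding A_def by (subst card_SigmaI) auto
  also have "card B = (\<Sum>n\<le>k. \<Sum>j<l. card (R n j))"
    unfolding B_def using fin by (subst card_SigmaI) (auto intro!: sum.cong card_SigmaI)
  finally have "int (card (idx k))
      = (\<Sum>n\<le>k. int (k - n + 1)) + (\<Sum>n\<le>k. \<Sum>j<l. int (card (R n j)))"
    by simp
  also have "(\<Sum>n\<le>k. int (k - n + 1)) = (\<Sum>n\<le>k. int k + 1 - int n)"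
    by (intro sum.cong) auto
  also have "(\<Sum>n\<le>k. \<Sum>j<l. int (card (R n j)))
      = (\<Sum>n\<le>k. int l * (int k + 1 - int n) + defect + int m * int ((l - 1) * n))"
  proof (intro sum.cong refl)
    fix n assume "n \<in> {..k}"
    then have "(\<Sum>j<l. int (card (R n j))) = (\<Sum>j<l. int k + 1 - int n
        + (int m * (int ((l - 1) * n) - int j)) div int l)"
      unfolding R_def using k by (intro sum.cong refl) (simp add: card_row)
    also have "\<dots> = int l * (int k + 1 - int n) + defect + int m * int ((l - 1) * n)"
      unfolding sum.distrib floor_sum_shift[OF l_pos] defect_def by simp
    finally show "(\<Sum>j<l. int (card (R n j)))
        = int l * (int k + 1 - int n) + defect + int m * int ((l - 1) * n)" .
  qed
  finally show ?thesis .
qed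

definition hilbert_poly :: "rat poly" where
  "hilbert_poly = [: of_nat l + 1 + of_int defect,
     (3 * (of_nat l + 1) + of_nat m * (of_nat l - 1)) / 2 + of_int defect,
     (of_nat l + 1 + of_nat m * (of_nat l - 1)) / 2 :]"

lemma dim_G_hilbert_poly:
  assumes "m \<le> k"
  shows "of_nat (ratfun.K.dim (G k)) = poly hilbert_poly (of_nat k)"
proof -
  have ln: "rat_of_nat ((l - 1) * n) = (of_nat l - 1) * of_nat n" for n
    using l_pos by (simp add: of_nat_diff)
  have "(of_nat (card (idx k)) :: rat) = of_int (int (card (idx k)))"
    by simp
  also have "\<dots> = (\<Sum>n\<le>k. (of_nat k + 1) + (- 1) * of_nat n)
      + (\<Sum>n\<le>k. (of_nat l * (of_nat k + 1) + of_int defect)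
          + (of_nat m * (of_nat l - 1) - of_nat l) * of_nat n)"
    unfolding card_idx[OF assms] of_int_add of_int_sum
    by (rule arg_cong2[of _ _ _ _ "(+)"]; rule sum.cong[OF refl])
      (simp_all only: of_int_add of_int_diff of_int_mult of_int_of_nat_eq of_int_1 ln,
       simp_all add: algebra_simps)
  also have "\<dots> = poly hilbert_poly (of_nat k)"
    unfolding sum_arith_progression by (simp add: hilbert_poly_def field_simps)
  finally show ?thesis
    unfolding dim_G .
qed

lemma hilbert_poly_lead: "degree hilbert_poly = 2"
  "lead_coeff hilbert_poly = (of_nat l + 1 + of_nat m * (of_nat l - 1)) / 2"
proof -
  have "(of_nat l + 1 + of_nat m * (of_nat l - 1) :: rat) > 0"
    using l_pos by (intro add_pos_nonneg mult_nonneg_nonneg) auto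
  then show "degree hilbert_poly = 2"
    "lead_coeff hilbert_poly = (of_nat l + 1 + of_nat m * (of_nat l - 1)) / 2"
    by (simp_all add: hilbert_poly_def)
qed

text \<open>
  The element \<open>X ^ i * g ^ r\<close> lies in \<open>G (i + r)\<close>, and stability under multiplication by \<open>Y\<close> then captures every
  \<open>X ^ i * Y ^ j * g ^ r\<close>, including those with \<open>j \<ge> l\<close>.
\<close>

lemma Union_G:
  assumes F: "f = to_fract F"
  shows "(\<Union>k. G k) = poly_localization F"
proof -
  have F0: "to_fract F \<noteq> 0"
    using f_nonzero F by simp
  have poly: "to_fract p / to_fract F ^ n \<in> poly_localization F" for p n
    unfolding poly_localization_def by blast
  have loc: "ratfun.K.subspace (poly_localization F)"
  proof (rule ratfun.K.subspaceI)
    show "0 \<in> poly_localization F"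
      using poly[of 0 0] by simp
  next
    fix u v assume "u \<in> poly_localization F" "v \<in> poly_localization F"
    then obtain p q a b where "u = to_fract p / to_fract F ^ a" "v = to_fract q / to_fract F ^ b"
      by (auto simp: poly_localization_def)
    then have "u + v = to_fract (p * F ^ b + q * F ^ a) / to_fract F ^ (a + b)"
      using F0 by (simp add: add_frac_eq power_add to_fract_power)
    then show "u + v \<in> poly_localization F"
      by (simp only: poly)
  next
    fix c u assume "u \<in> poly_localization F"
    then show "ratfun_act (weyl_const c) u \<in> poly_localization F"
      using F0 by (intro poly_localization_submodule) auto
  qed
  have mono: "u \<in> G k'" if "k \<le> k'" "u \<in> G k" for u k k'
    using that by (induction k' rule: dec_induct) (auto intro: G_stable)
  have gr: "u * g ^ r \<in> (\<Union>k. G k)" if u: "u \<in> ratfun.K.span {X ^ i * Y ^ j | i j. True}" for u r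
  proof (rule span_image_mono[OF _ _ _ _ u])
    show "ratfun.K.subspace (\<Union>k. G k)"
    proof (rule ratfun.K.subspaceI)
      show "0 \<in> (\<Union>k. G k)"
        using ratfun.K.subspace_0[OF G_subspace] by blast
    next
      fix u v assume "u \<in> (\<Union>k. G k)" "v \<in> (\<Union>k. G k)"
      then obtain a b where "u \<in> G a" "v \<in> G b" by blast
      then have "u \<in> G (max a b)" "v \<in> G (max a b)"
        by (auto intro: mono[OF max.cobounded1] mono[OF max.cobounded2])
      then show "u + v \<in> (\<Union>k. G k)"
        using ratfun.K.subspace_add[OF G_subspace] by blast
    next
      fix c u assume "u \<in> (\<Union>k. G k)"
      then show "ratfun_act (weyl_const c) u \<in> (\<Union>k. G k)"
        using ratfun.K.subspace_scale[OF G_subspace] by blast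
    qed
    fix v assume "v \<in> {X ^ i * Y ^ j | i j. True}"
    then obtain i j where v: "v = X ^ i * Y ^ j" by blast
    have "\<exists>k. e (i, j, r) \<in> G k"
    proof (induction j)
      case 0
      have "(i, 0, r) \<in> idx (i + r)"
      proof (cases r)
        case (Suc n)
        have "m * n \<le> l + l * (m * n)"
          using l_pos by (cases l) simp_all
        then show ?thesis
          using l_pos by (simp add: Suc idx_Suc algebra_simps)
      qed (simp add: idx_0)
      then show ?case by (blast intro: e_in_G)
    next
      case (Suc j)
      then show ?case
        using G_stable(3) by (metis Y_e)
    qed
    then show "v * g ^ r \<in> (\<Union>k. G k)"
      by (simp add: v e_def)
  qed (simp_all add: algebra_simps)
  show ?thesis
  proof
    show "(\<Union>k. G k) \<subseteq> poly_localization F"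
    proof (rule UN_least)
      fix k
      have "e (i, j, r) \<in> poly_localization F" for i j r
      proof -
        have "X ^ i * Y ^ j \<in> range to_fract"
          unfolding polynomials by (intro ratfun.K.span_base) blast
        then obtain p where "X ^ i * Y ^ j = to_fract p" by blast
        then have "e (i, j, r) = to_fract p / to_fract F ^ r"
          by (simp add: e_def g_def F divide_inverse power_inverse)
        then show ?thesis by (simp only: poly)
      qed
      then show "G k \<subseteq> poly_localization F"
        unfolding G_def by (intro ratfun.K.span_minimal[OF _ loc]) auto
    qed
    show "poly_localization F \<subseteq> (\<Union>k. G k)"
    proof
      fix u assume "u \<in> poly_localization F"
      then obtain p n where u: "u = to_fract p / to_fract F ^ n"
        by (auto simp: poly_localization_def)
      have "to_fract p \<in> ratfun.K.span {X ^ i * Y ^ j | i j. True}"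
        unfolding polynomials[symmetric] by simp
      then have "to_fract p * g ^ n \<in> (\<Union>k. G k)"
        by (rule gr)
      then show "u \<in> (\<Union>k. G k)"
        by (simp add: u g_def F divide_inverse power_inverse)
    qed
  qed
qed

lemma curve_multiplicity:
  assumes F: "f = to_fract F"
    and XY: "X = ratfun_x \<and> Y = ratfun_y \<and> dX = ratfun_dx \<and> dY = ratfun_dy \<or>
      X = ratfun_y \<and> Y = ratfun_x \<and> dX = ratfun_dy \<and> dY = ratfun_dx"
  shows "bernstein_multiplicity ratfun_act (poly_localization F)
    = of_nat l * of_nat m + (of_nat l - of_nat m) + 1"
proof -
  interpret bernstein_exhaustion G
  proof
    fix u k assume u: "u \<in> G k"
    show "u \<in> G (Suc k)" "ratfun_x * u \<in> G (Suc k)" "ratfun_y * u \<in> G (Suc k)"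
      "ratfun_dx u \<in> G (Suc k)" "ratfun_dy u \<in> G (Suc k)"
      using XY G_stable[OF u] by auto
  qed (rule G_subspace)
  have "bernstein_multiplicity ratfun_act (\<Union>k. G k) = fact (degree hilbert_poly) * lead_coeff hilbert_poly"
  proof (rule multiplicity)
    show "finite (e ` idx (m + 2))"
      by (simp add: finite_idx)
    show "G (m + 2) = ratfun.K.span (e ` idx (m + 2))"
      by (rule G_def)
    show "G (Suc k) \<subseteq> S"
      if "m + 2 \<le> k" "ratfun.K.subspace S" "\<And>u. u \<in> G k \<Longrightarrow> u \<in> S \<and> ratfun_x * u \<in> S \<and>
        ratfun_y * u \<in> S \<and> ratfun_dx u \<in> S \<and> ratfun_dy u \<in> S" for k S
      by (rule G_generated) (use that XY in auto)
  qed (simp add: dim_G_hilbert_poly)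
  then show ?thesis
    unfolding Union_G[OF F] hilbert_poly_lead(2) unfolding hilbert_poly_lead(1)
    by (simp add: fact_2 algebra_simps)
qed

end

section \<open>The two orderings of the coordinates\<close>

lemma range_to_fract_eq_span:
  "range (to_fract :: 'a::field_char_0 poly poly \<Rightarrow> _)
    = ratfun.K.span {ratfun_x ^ i * ratfun_y ^ j | i j. True}" (is "_ = ratfun.K.span ?M")
proof
  show "range to_fract \<subseteq> ratfun.K.span ?M"
  proof
    fix u :: "'a poly poly fract" assume "u \<in> range to_fract"
    then obtain p where u: "u = to_fract p" by blast
    have "p = (\<Sum>b\<le>degree p. monom (\<Sum>a\<le>degree (coeff p b). monom (coeff (coeff p b) a) a) b)"
      by (simp only: poly_as_sum_of_monoms)
    also have "\<dots> = (\<Sum>b\<le>degree p. \<Sum>a\<le>degree (coeff p b). monom (monom (coeff (coeff p b) a) a) b)"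
      by (simp only: monom_sum)
    finally have "u = to_fract \<dots>"
      unfolding u by (rule arg_cong)
    also have "\<dots> = (\<Sum>b\<le>degree p. \<Sum>a\<le>degree (coeff p b).
        ratfun_const (coeff (coeff p b) a) * (ratfun_x ^ a * ratfun_y ^ b))"
      by (simp only: ratfun_monom mult.assoc[symmetric] to_fract_sum)
    also have "\<dots> \<in> ratfun.K.span ?M"
      unfolding ratfun_act_weyl_const[symmetric]
      by (intro ratfun.K.span_sum ratfun.K.span_scale ratfun.K.span_base) blast
    finally show "u \<in> ratfun.K.span ?M" .
  qed
  have "ratfun.K.subspace (range (to_fract :: 'a poly poly \<Rightarrow> _))"
  proof (rule ratfun.K.subspaceI)
    show "0 \<in> range (to_fract :: 'a poly poly \<Rightarrow> _)"
      by (metis rangeI to_fract_0)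
  qed (auto simp: ratfun_const_def simp flip: to_fract_add to_fract_mult)
  moreover have "?M \<subseteq> range to_fract"
    by (auto simp: ratfun_x_def ratfun_y_def simp flip: to_fract_power to_fract_mult)
  ultimately show "ratfun.K.span ?M \<subseteq> range to_fract"
    by (rule ratfun.K.span_minimal[rotated])
qed

lemma coordinates_xy: "coordinates ratfun_dx ratfun_dy ratfun_x ratfun_y"
  by unfold_locales (simp_all add: range_to_fract_eq_span)

lemma coordinates_yx: "coordinates ratfun_dy ratfun_dx ratfun_y ratfun_x"
proof -
  have "{ratfun_y ^ i * ratfun_x ^ j :: 'a poly poly fract | i j. True} = {ratfun_x ^ i * ratfun_y ^ j | i j. True}"
    by (auto simp: mult.commute)
  then show ?thesis
    by unfold_locales (simp_all add: range_to_fract_eq_span)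
qed

theorem proposition4p5:
  fixes l m :: nat and f :: "'a::field_char_0 poly poly"
  assumes "l > 0" and "m > 0"
    and "f = [:[:0, 1:]:] ^ m + [:0, 1:] ^ l + 1"
  shows "bernstein_multiplicity ratfun_act (poly_localization f)
    = of_int (int l * int m + \<bar>int l - int m\<bar> + 1)"
proof -
  have f: "to_fract f = ratfun_x ^ m + ratfun_y ^ l + 1"
    by (simp add: assms(3) ratfun_x_def ratfun_y_def to_fract_power)
  show ?thesis
  proof (cases "m \<le> l")
    case True
    interpret curve ratfun_dx ratfun_dy "ratfun_x :: 'a poly poly fract" ratfun_y l m
      using True assms by (intro curve.intro curve_axioms.intro coordinates_xy) auto
    show ?thesis
      using curve_multiplicity[of f] f f_def True by simp
  next
    case False
    interpret curve ratfun_dy ratfun_dx "ratfun_y :: 'a poly poly fract" ratfun_x m l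
      using False assms by (intro curve.intro curve_axioms.intro coordinates_yx) auto
    show ?thesis
      using curve_multiplicity[of f] f f_def False by (simp add: algebra_simps)
  qed
qed

end
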